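(* For every constant $c>0$ there is a deterministic polynomial-time algorithm which, given a monotone $\mathsf{NC}^0_3$ circuit $C:\{0,1\}^n\to\{0,1\}^m$ with $m>cn^2$ (and $m>n$), outputs a string $y\in\{0,1\}^m$ with $y\notin\mathrm{Range}(C)$.
   Context: $\mathrm{Range}(C)=\{C(x):x\in\{0,1\}^n\}$. A monotone $\mathsf{NC}^0_3$ circuit is a constant-depth, bounded fan-in circuit with only $\wedge,\vee$ gates (no negations) in which each output bit depends on at most $3$ input bits; equivalently each output bit is a monotone Boolean function of at most $3$ of the input variables. *)

theory Defs
  imports Complex_Main "HOL-Computational_Algebra.Polynomial"
begin

section \<open>Polynomial-time algorithms\<close>

text \<open>
  The machine model is the WHILE language of N. D. Jones (Computability and Complexity
  from a Programming Perspective, MIT Press 1997): flowchart-structured programs over binary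
  trees, with finitely many variables per program. Every operator evaluation, assignment and
  test costs one unit. Trees can be shared, so a Turing machine that stores the variables as
  pointers into a growing acyclic graph simulates \<open>t\<close> steps with polynomial overhead
  (a step creates a number of new cells bounded by the program text and inspects only the
  roots of trees; there is no unit-cost equality test). Conversely a Turing machine tape is a pair of lists.
  The class of functions with polynomially bounded output computable in polynomial time
  is therefore the usual one.
\<close>

datatype data = Leaf | Node data data

datatype expr = EVar nat | ENil | ECons expr expr | EHd expr | ETl expr

datatype com =
    Skip
  | Assign nat expr
  | Seq com com
  | Cond expr com com
  | While expr com

type_synonym store = "nat \<Rightarrow> data"

fun hd_data :: "data \<Rightarrow> data" where
  "hd_data Leaf = Leaf"
| "hd_data (Node a b) = a"

fun tl_data :: "data \<Rightarrow> data" where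
  "tl_data Leaf = Leaf"
| "tl_data (Node a b) = b"

fun eval_expr :: "expr \<Rightarrow> store \<Rightarrow> data" where
  "eval_expr (EVar v) s = s v"
| "eval_expr ENil s = Leaf"
| "eval_expr (ECons e f) s = Node (eval_expr e s) (eval_expr f s)"
| "eval_expr (EHd e) s = hd_data (eval_expr e s)"
| "eval_expr (ETl e) s = tl_data (eval_expr e s)"

fun cost_expr :: "expr \<Rightarrow> nat" where
  "cost_expr (EVar v) = 1"
| "cost_expr ENil = 1"
| "cost_expr (ECons e f) = 1 + cost_expr e + cost_expr f"
| "cost_expr (EHd e) = 1 + cost_expr e"
| "cost_expr (ETl e) = 1 + cost_expr e"

text \<open>\<open>exec p s t s'\<close>: started in store \<open>s\<close>, program \<open>p\<close> halts after exactly \<open>t\<close> time units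
  in store \<open>s'\<close>. \<open>Leaf\<close> counts as false in tests.\<close>

inductive exec :: "com \<Rightarrow> store \<Rightarrow> nat \<Rightarrow> store \<Rightarrow> bool" where
  Skip: "exec Skip s 1 s"
| Assign: "exec (Assign v e) s (1 + cost_expr e) (s(v := eval_expr e s))"
| Seq: "exec p s t s' \<Longrightarrow> exec q s' u s'' \<Longrightarrow> exec (Seq p q) s (t + u) s''"
| CondTrue: "eval_expr e s \<noteq> Leaf \<Longrightarrow> exec p s t s' \<Longrightarrow>
    exec (Cond e p q) s (1 + cost_expr e + t) s'"
| CondFalse: "eval_expr e s = Leaf \<Longrightarrow> exec q s t s' \<Longrightarrow>
    exec (Cond e p q) s (1 + cost_expr e + t) s'"
| WhileTrue: "eval_expr e s \<noteq> Leaf \<Longrightarrow> exec p s t s' \<Longrightarrow> exec (While e p) s' u s'' \<Longrightarrow>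
    exec (While e p) s (1 + cost_expr e + t + u) s''"
| WhileFalse: "eval_expr e s = Leaf \<Longrightarrow> exec (While e p) s (1 + cost_expr e) s"

inductive_cases SkipE: "exec Skip s t s'"
inductive_cases AssignE: "exec (Assign v e) s t s'"
inductive_cases SeqE: "exec (Seq p q) s t s'"
inductive_cases CondE: "exec (Cond e p q) s t s'"
inductive_cases WhileE: "exec (While e p) s t s'"

lemma exec_deterministic: "exec p s t s' \<Longrightarrow> exec p s u s'' \<Longrightarrow> t = u \<and> s' = s''"
proof (induction arbitrary: u s'' rule: exec.induct)
  case (Skip s)
  then show ?case by (auto elim: SkipE)
next
  case (Assign v e s)
  then show ?case by (auto elim: AssignE)
next
  case (Seq p s t s' q t' s2)
  from Seq.prems show ?case
    by (rule SeqE) (metis Seq.IH)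
next
  case (CondTrue e s p t s' q)
  from CondTrue.prems show ?case
    by (rule CondE) (use CondTrue.IH CondTrue.hyps in \<open>fastforce+\<close>)
next
  case (CondFalse e s q t s' p)
  from CondFalse.prems show ?case
    by (rule CondE) (use CondFalse.IH CondFalse.hyps in \<open>fastforce+\<close>)
next
  case (WhileTrue e s p t s' t' s2)
  from WhileTrue.prems show ?case
    by (rule WhileE) (use WhileTrue.IH WhileTrue.hyps(1) in \<open>fastforce+\<close>)
next
  case (WhileFalse e s p)
  from WhileFalse.prems show ?case
    by (rule WhileE) (use WhileFalse.hyps in \<open>fastforce+\<close>)
qed

text \<open>Variable 0 carries the input and the output; all others start as \<open>Leaf\<close>.\<close>

definition computes_in :: "com \<Rightarrow> data \<Rightarrow> nat \<Rightarrow> data \<Rightarrow> bool" where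
  "computes_in p a t b \<longleftrightarrow> (\<exists>s. exec p ((\<lambda>_. Leaf)(0 := a)) t s \<and> s 0 = b)"

text \<open>A search problem: on each instance \<open>x \<in> D\<close> (a promise) some \<open>y\<close> with \<open>R x y\<close> is to be
  output. One program and one polynomial serve all instances; \<open>size\<close> is the number of
  \<open>Node\<close> cells of the encoded instance.\<close>

definition poly_time_solvable ::
  "('a \<Rightarrow> data) \<Rightarrow> ('b \<Rightarrow> data) \<Rightarrow> 'a set \<Rightarrow> ('a \<Rightarrow> 'b \<Rightarrow> bool) \<Rightarrow> bool" where
  "poly_time_solvable enc_in enc_out D R \<longleftrightarrow>
     (\<exists>(p :: com) (q :: nat poly). \<forall>x\<in>D. \<exists>y t.
        computes_in p (enc_in x) t (enc_out y) \<and> t \<le> poly q (size (enc_in x)) \<and> R x y)"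

section \<open>Monotone circuits of locality three\<close>

text \<open>An output gate \<open>(vs, tt)\<close> lists the input variables it reads together with its truth table;
  the entry for the values \<open>bs\<close> of \<open>vs\<close> sits at the position with binary digits \<open>bs\<close>, least
  significant first. Constants are the gates with \<open>vs = []\<close>.\<close>

type_synonym gate = "nat list \<times> bool list"

datatype circuit = Circuit (num_inputs: nat) (gates: "gate list")

abbreviation num_outputs :: "circuit \<Rightarrow> nat" where
  "num_outputs C \<equiv> length (gates C)"

definition bits :: "nat \<Rightarrow> bool list set" where
  "bits n = {x. length x = n}"

definition eval_gate :: "gate \<Rightarrow> bool list \<Rightarrow> bool" where
  "eval_gate g x = snd g ! horner_sum of_bool 2 (map (\<lambda>i. x ! i) (fst g))"

definition eval_circuit :: "circuit \<Rightarrow> bool list \<Rightarrow> bool list" where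
  "eval_circuit C x = map (\<lambda>g. eval_gate g x) (gates C)"

definition circuit_range :: "circuit \<Rightarrow> bool list set" where
  "circuit_range C = eval_circuit C ` bits (num_inputs C)"

definition local_gate :: "nat \<Rightarrow> nat \<Rightarrow> gate \<Rightarrow> bool" where
  "local_gate k n g \<longleftrightarrow> distinct (fst g) \<and> set (fst g) \<subseteq> {..<n} \<and> length (fst g) \<le> k \<and>
     length (snd g) = 2 ^ length (fst g)"

definition monotone_gate :: "nat \<Rightarrow> gate \<Rightarrow> bool" where
  "monotone_gate n g \<longleftrightarrow>
     (\<forall>x\<in>bits n. \<forall>y\<in>bits n. list_all2 (\<le>) x y \<longrightarrow> eval_gate g x \<le> eval_gate g y)"

definition monotone_NC0 :: "nat \<Rightarrow> circuit \<Rightarrow> bool" where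
  "monotone_NC0 k C \<longleftrightarrow>
     (\<forall>g\<in>set (gates C). local_gate k (num_inputs C) g \<and> monotone_gate (num_inputs C) g)"

text \<open>Encodings as trees. Numbers are written in unary; a circuit with more outputs than
  inputs then has an encoding of size polynomial in its number of outputs, which is a lower
  bound for the length of any encoding listing the gates, so polynomial time means the same as with
  binary indices.\<close>

definition enc_list :: "('a \<Rightarrow> data) \<Rightarrow> 'a list \<Rightarrow> data" where
  "enc_list enc xs = foldr (\<lambda>x d. Node (enc x) d) xs Leaf"

definition enc_bool :: "bool \<Rightarrow> data" where
  "enc_bool b = (if b then Node Leaf Leaf else Leaf)"

definition enc_nat :: "nat \<Rightarrow> data" where
  "enc_nat n = enc_list (\<lambda>_. Leaf) [0..<n]"

definition enc_gate :: "gate \<Rightarrow> data" where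
  "enc_gate g = Node (enc_list enc_nat (fst g)) (enc_list enc_bool (snd g))"

definition enc_circuit :: "circuit \<Rightarrow> data" where
  "enc_circuit C = Node (enc_nat (num_inputs C)) (enc_list enc_gate (gates C))"

end

theory Submission imports Defs begin

text \<open>
  The point is that constantly many outputs suffice: there is a \<open>K\<close> depending only on \<open>c\<close> such that
  some prescribed values of at most \<open>K\<close> outputs are unattainable. Such a pattern is found in
  polynomial time by exhaustive search, where attainability is tested on the inputs with at most
  \<open>3 * K\<close> ones. For bounded \<open>n\<close> any \<open>n + 1\<close> outputs do, by counting. For large \<open>n\<close>, a set of
  variables that is minimal with respect to spanning too many gates yields a subcircuit in which
  every variable is read by linearly many gates. Assume \<open>x = b\<close> there. A monotone gate
  that reads a variable of known value depends on at most two others, so one of its two output values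
  forces a further variable. Hence, as long as nothing is contradictory, each gate touching the
  known variables contributes a new one; applying this to the gates at \<open>x\<close> and then to all gates at
  the variables obtained produces quadratically many variables, which is absurd. So
  boundedly many outputs refute \<open>x = 0\<close>, and boundedly many of the remaining ones refute \<open>x = 1\<close>.
\<close>

section \<open>Small unattainable patterns\<close>

locale monotone_juntas =
  fixes V :: "nat set" and G :: "'i set" and S :: "'i \<Rightarrow> nat set"
    and f :: "'i \<Rightarrow> (nat \<Rightarrow> bool) \<Rightarrow> bool"
  assumes finite_V: "finite V" and finite_G: "finite G"
    and S_subset: "i \<in> G \<Longrightarrow> S i \<subseteq> V"
    and card_S: "i \<in> G \<Longrightarrow> card (S i) \<le> 3"
    and mono: "i \<in> G \<Longrightarrow> \<forall>v\<in>S i. \<zeta> v \<longrightarrow> \<xi> v \<Longrightarrow> f i \<zeta> \<Longrightarrow> f i \<xi>"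
begin

lemma finite_S: "i \<in> G \<Longrightarrow> finite (S i)"
  using S_subset finite_V finite_subset by blast

text \<open>At most two variables \<open>u\<close>, \<open>w\<close> of the gate are unknown. The
  test assignment \<open>\<xi>\<close> gives them 1 and 0. If the gate is 0 there, output 1 forces
  \<open>w\<close> to 1, since an assignment with \<open>w\<close> at 0 lies below
  \<open>\<xi>\<close>; if it is 1 there, output 0 forces \<open>u\<close> to 0 dually.\<close>

lemma forced_variable:
  assumes i: "i \<in> G" and "S i \<inter> D \<noteq> {}" "S i - D \<noteq> {}"
  shows "\<exists>w\<in>S i - D. \<exists>\<alpha> \<epsilon>. \<forall>\<zeta>. (\<forall>v\<in>S i \<inter> D. \<zeta> v = e v) \<and> f i \<zeta> = \<alpha> \<longrightarrow> \<zeta> w = \<epsilon>"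
proof -
  have "card (S i) = card (S i \<inter> D) + card (S i - D)"
    by (rule card_Int_Diff[OF finite_S[OF i]])
  moreover have "card (S i \<inter> D) \<noteq> 0"
    using assms finite_S[OF i] by simp
  ultimately have c2: "card (S i - D) \<le> 2"
    using card_S[OF i] by linarith
  obtain u where u: "u \<in> S i - D" using assms by blast
  obtain w where w: "w \<in> S i - D" and uw: "S i - D = {u, w}"
  proof (cases "S i - D = {u}")
    case True
    with that[of u] u show ?thesis by simp
  next
    case False
    then obtain w where w: "w \<in> S i - D" "w \<noteq> u" using u by blast
    have "card {u, w} = 2" using w by simp
    then have "{u, w} = S i - D"
      using c2 u w finite_S[OF i] by (intro card_seteq) auto
    with that w show ?thesis by blast
  qed
  have other: "v \<in> S i \<inter> D \<or> v = u \<or> v = w" if "v \<in> S i" for v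
    using that uw by blast
  have notD: "u \<notin> D" "w \<notin> D" using u w by auto
  \<comment> \<open>If only one variable is unknown, so \<open>u = w\<close>, the later update wins;
    \<open>\<xi>\<close> then gives it 0 and both cases below still work.\<close>
  define \<xi> where "\<xi> = e(u := True, w := False)"
  have \<xi>: "\<And>v. v \<in> D \<Longrightarrow> \<xi> v = e v" "\<not> \<xi> w" "u \<noteq> w \<Longrightarrow> \<xi> u"
    using notD by (auto simp: \<xi>_def)
  show ?thesis
  proof (cases "f i \<xi>")
    case False
    have "\<zeta> w" if "\<forall>v\<in>S i \<inter> D. \<zeta> v = e v" "f i \<zeta>" for \<zeta>
    proof (rule ccontr)
      assume "\<not> \<zeta> w"
      have "\<forall>v\<in>S i. \<zeta> v \<longrightarrow> \<xi> v"
      proof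
        fix v assume v: "v \<in> S i"
        show "\<zeta> v \<longrightarrow> \<xi> v"
          using other[OF v]
        proof (elim disjE)
          assume "v \<in> S i \<inter> D"
          then show ?thesis using that(1) \<xi>(1)[of v] by simp
        next
          assume "v = u"
          then show ?thesis using \<xi>(3) \<open>\<not> \<zeta> w\<close> by blast
        next
          assume "v = w"
          then show ?thesis using \<open>\<not> \<zeta> w\<close> by simp
        qed
      qed
      then show False using mono[OF i] that(2) False by blast
    qed
    with w show ?thesis by (intro bexI[of _ w] exI[of _ True]) auto
  next
    case True
    have "\<not> \<zeta> u" if "\<forall>v\<in>S i \<inter> D. \<zeta> v = e v" "\<not> f i \<zeta>" for \<zeta>
    proof
      assume "\<zeta> u"
      have "\<forall>v\<in>S i. \<xi> v \<longrightarrow> \<zeta> v"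
      proof
        fix v assume v: "v \<in> S i"
        show "\<xi> v \<longrightarrow> \<zeta> v"
          using other[OF v]
        proof (elim disjE)
          assume "v \<in> S i \<inter> D"
          then show ?thesis using that(1) \<xi>(1)[of v] by simp
        next
          assume "v = u"
          then show ?thesis using \<open>\<zeta> u\<close> by simp
        next
          assume "v = w"
          then show ?thesis using \<xi>(2) by simp
        qed
      qed
      then show False using mono[OF i] that(2) True by blast
    qed
    with u show ?thesis by (intro bexI[of _ u] exI[of _ False]) auto
  qed
qed

text \<open>\<open>mono\<close> compares assignments on \<open>S i\<close> only, so used in both
  directions it also says that the gate reads nothing else.\<close>

lemma determined_value:
  assumes "i \<in> G" "\<forall>v\<in>S i. \<zeta> v = \<xi> v"
  shows "f i \<zeta> = f i \<xi>"
  using mono[OF assms(1)] assms(2) by blast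

text \<open>\<open>D\<close> are the variables whose values follow from \<open>x = b\<close> once the outputs in \<open>U\<close> are
  suitably prescribed; each of them follows from at most \<open>s\<close> of these outputs, and every output
  in \<open>U\<close> has contributed a new variable.\<close>

definition propagated :: "nat \<Rightarrow> bool \<Rightarrow> nat \<Rightarrow> nat set \<Rightarrow> 'i set \<Rightarrow> bool" where
  "propagated x b s D U \<longleftrightarrow> D \<subseteq> V \<and> U \<subseteq> G \<and> card D = card U + 1 \<and>
     (\<exists>\<alpha> e. \<forall>y\<in>D. \<exists>W\<subseteq>U. card W \<le> s \<and>
        (\<forall>\<zeta>. \<zeta> x = b \<and> (\<forall>i\<in>W. f i \<zeta> = \<alpha> i) \<longrightarrow> \<zeta> y = e y))"

definition irrefutable :: "nat \<Rightarrow> bool \<Rightarrow> nat \<Rightarrow> bool" where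
  "irrefutable x b N \<longleftrightarrow>
     (\<forall>W \<alpha>. W \<subseteq> G \<and> card W \<le> N \<longrightarrow> (\<exists>\<zeta>. \<zeta> x = b \<and> (\<forall>i\<in>W. f i \<zeta> = \<alpha> i)))"

lemma refutableE:
  assumes "\<not> irrefutable x b N"
  obtains W \<alpha> where "W \<subseteq> G" "card W \<le> N"
    "\<forall>\<zeta>. \<zeta> x = b \<longrightarrow> (\<exists>i\<in>W. f i \<zeta> \<noteq> \<alpha> i)"
proof -
  from assms obtain W \<alpha>
    where W: "\<not> (W \<subseteq> G \<and> card W \<le> N \<longrightarrow> (\<exists>\<zeta>. \<zeta> x = b \<and> (\<forall>i\<in>W. f i \<zeta> = \<alpha> i)))"
    unfolding irrefutable_def not_all by (elim exE) (rule that)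
  from W have W': "W \<subseteq> G" "card W \<le> N" "\<nexists>\<zeta>. \<zeta> x = b \<and> (\<forall>i\<in>W. f i \<zeta> = \<alpha> i)"
    by (simp_all only: not_imp not_False_eq_True)
  from W'(3) have "\<forall>\<zeta>. \<zeta> x = b \<longrightarrow> (\<exists>i\<in>W. f i \<zeta> \<noteq> \<alpha> i)"
    unfolding not_ex by (intro allI impI) (drule spec, erule contrapos_np, simp)
  with W'(1,2) show ?thesis by (rule that)
qed

text \<open>Every gate outside \<open>U\<close> that meets \<open>D\<close> forces a new variable,
  by \<open>forced_variable\<close>. The new value rests on the gate itself and on the outputs
  behind its at most three known variables, hence \<open>3 * s + 1\<close>.\<close>

lemma propagation_round:
  assumes base: "propagated x b s D U" and irr: "irrefutable x b N" and N: "3 * s + 1 \<le> N"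
  obtains D' U' where "propagated x b (3 * s + 1) D' U'" "D \<subseteq> D'" "U \<subseteq> U'"
    "\<And>i. i \<in> G - U' \<Longrightarrow> S i \<inter> D \<noteq> {} \<Longrightarrow> card (S i \<inter> D) < card (S i \<inter> D')"
proof -
  from base obtain \<alpha> e where DU: "D \<subseteq> V" "U \<subseteq> G" "card D = card U + 1"
    and ex: "\<forall>y\<in>D. \<exists>W\<subseteq>U. card W \<le> s \<and>
        (\<forall>\<zeta>. \<zeta> x = b \<and> (\<forall>i\<in>W. f i \<zeta> = \<alpha> i) \<longrightarrow> \<zeta> y = e y)"
    unfolding propagated_def by (elim conjE exE) (rule that)
  from bchoice[OF ex] obtain W where W': "\<forall>y\<in>D. W y \<subseteq> U \<and> card (W y) \<le> s \<and>
        (\<forall>\<zeta>. \<zeta> x = b \<and> (\<forall>i\<in>W y. f i \<zeta> = \<alpha> i) \<longrightarrow> \<zeta> y = e y)" ..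
  then have W: "\<And>y. y \<in> D \<Longrightarrow> W y \<subseteq> U"
      "\<And>y. y \<in> D \<Longrightarrow> card (W y) \<le> s"
      "\<And>y \<zeta>. y \<in> D \<Longrightarrow> \<zeta> x = b \<Longrightarrow> (\<forall>i\<in>W y. f i \<zeta> = \<alpha> i) \<Longrightarrow> \<zeta> y = e y"
    by simp_all
  have finU: "finite U" and finD: "finite D"
    using DU finite_G finite_V finite_subset by auto
  \<comment> \<open>\<open>X i\<close> collects the outputs that pin down the known variables of
    gate \<open>i\<close>.\<close>
  define X where "X i = (\<Union>y\<in>S i \<inter> D. W y)" for i
  have X: "X i \<subseteq> U" "card (insert i (X i)) \<le> 3 * s + 1" if "i \<in> G" for i
  proof -
    show "X i \<subseteq> U" using W(1) by (auto simp: X_def)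
    have "card (X i) \<le> (\<Sum>y\<in>S i \<inter> D. card (W y))"
      unfolding X_def using finite_S[OF that] by (intro card_UN_le) auto
    also have "\<dots> \<le> (\<Sum>y\<in>S i \<inter> D. s)" using W(2) by (intro sum_mono) auto
    also have "\<dots> = card (S i \<inter> D) * s" by simp
    also have "card (S i \<inter> D) \<le> 3"
      using card_S[OF that] card_mono[of "S i" "S i \<inter> D"] finite_S[OF that] by auto
    finally have "card (X i) \<le> 3 * s" by simp
    moreover have "finite (X i)" using \<open>X i \<subseteq> U\<close> finU finite_subset by blast
    ultimately show "card (insert i (X i)) \<le> 3 * s + 1" by (simp add: card_insert_if)
  qed
  have X_det: "\<zeta> y = e y" if "\<zeta> x = b" "\<forall>j\<in>X i. f j \<zeta> = \<alpha> j" "y \<in> S i \<inter> D" for \<zeta> i y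
    using W(3)[of y \<zeta>] that by (auto simp: X_def)
  define H where "H = {i\<in>G - U. S i \<inter> D \<noteq> {}}"
  have "\<exists>w a \<epsilon>. w \<in> S i - D \<and> (\<forall>\<zeta>. (\<forall>v\<in>S i \<inter> D. \<zeta> v = e v) \<and> f i \<zeta> = a \<longrightarrow> \<zeta> w = \<epsilon>)"
    if "i \<in> H" for i
  proof -
    have i: "i \<in> G" "i \<notin> U" "S i \<inter> D \<noteq> {}" using that by (auto simp: H_def)
    \<comment> \<open>Otherwise \<open>x = b\<close> and the outputs in \<open>X i\<close> determine
      gate \<open>i\<close>, and prescribing the opposite value for it refutes \<open>x = b\<close>
      with at most \<open>N\<close> outputs. As \<open>i\<close> lies outside \<open>U\<close>, the
      update does not disturb the prescriptions on \<open>X i\<close>.\<close>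
    have "S i - D \<noteq> {}"
    proof
      assume sub: "S i - D = {}"
      let ?\<alpha> = "\<alpha>(i := \<not> f i e)"
      have "insert i (X i) \<subseteq> G" "card (insert i (X i)) \<le> N"
        using X[OF i(1)] i(1) DU N by auto
      then obtain \<zeta> where \<zeta>: "\<zeta> x = b" "\<forall>j\<in>insert i (X i). f j \<zeta> = ?\<alpha> j"
        using irr unfolding irrefutable_def by blast
      have "\<forall>j\<in>X i. f j \<zeta> = \<alpha> j"
        using \<zeta>(2) X(1)[OF i(1)] i(2) by (metis fun_upd_other insertI2 subsetD)
      then have "\<forall>v\<in>S i. \<zeta> v = e v" using X_det[of \<zeta> i] \<zeta>(1) sub by blast
      then have "f i \<zeta> = f i e" by (rule determined_value[OF i(1)])
      then show False using \<zeta>(2) by simp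
    qed
    from forced_variable[OF i(1,3) this, of e] show ?thesis by blast
  qed
  then obtain w a \<epsilon> where tgt: "\<And>i. i \<in> H \<Longrightarrow> w i \<in> S i - D"
      "\<And>i \<zeta>. i \<in> H \<Longrightarrow> (\<forall>v\<in>S i \<inter> D. \<zeta> v = e v) \<Longrightarrow> f i \<zeta> = a i \<Longrightarrow> \<zeta> (w i) = \<epsilon> i"
    by metis
  \<comment> \<open>Several gates may force the same variable. \<open>r\<close> picks one of them
    per new variable, and only these join \<open>U\<close>, which keeps the cardinalities in step. A
    gate left out still has its target in \<open>D'\<close>.\<close>
  define r where "r = inv_into H w"
  have r: "r v \<in> H" "w (r v) = v" if "v \<in> w ` H" for v
    using that by (auto simp: r_def inv_into_into f_inv_into_f)
  have inj: "inj_on r (w ` H)"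
    unfolding r_def by (rule inj_on_inv_into) simp
  have HG: "H \<subseteq> G" "H \<inter> U = {}" and finH: "finite H"
    using finite_G by (auto simp: H_def)
  define D' where "D' = D \<union> w ` H"
  define U' where "U' = U \<union> r ` w ` H"
  define \<alpha>' where "\<alpha>' i = (if i \<in> U then \<alpha> i else a i)" for i
  define e' where "e' v = (if v \<in> D then e v else \<epsilon> (r v))" for v
  have wD: "v \<notin> D" if "v \<in> w ` H" for v using that tgt(1) by blast
  have "card D' = card D + card (w ` H)"
    unfolding D'_def using finD finH wD by (intro card_Un_disjoint) auto
  moreover have "card U' = card U + card (r ` w ` H)"
    unfolding U'_def using finU finH HG r(1) by (intro card_Un_disjoint) auto
  ultimately have cards: "card D' = card U' + 1"
    using DU(3) card_image[OF inj] by simp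
  have "w ` H \<subseteq> V" using tgt(1) S_subset HG by blast
  then have sub: "D' \<subseteq> V" "U' \<subseteq> G"
    using DU HG r(1) by (auto simp: D'_def U'_def)
  have "\<exists>Z\<subseteq>U'. card Z \<le> 3 * s + 1 \<and>
      (\<forall>\<zeta>. \<zeta> x = b \<and> (\<forall>i\<in>Z. f i \<zeta> = \<alpha>' i) \<longrightarrow> \<zeta> y = e' y)" if "y \<in> D'" for y
  proof (cases "y \<in> D")
    case True
    have "\<forall>i\<in>W y. \<alpha>' i = \<alpha> i" using W(1)[OF True] by (auto simp: \<alpha>'_def)
    then show ?thesis
      using W[OF True] True by (intro exI[of _ "W y"]) (auto simp: U'_def e'_def)
  next
    case False
    then have y: "y \<in> w ` H" using that by (simp add: D'_def)
    let ?i = "r y"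
    have i: "?i \<in> H" "?i \<in> G" "?i \<notin> U" using r[OF y] HG by auto
    have "insert ?i (X ?i) \<subseteq> U'" using X(1)[OF i(2)] y by (auto simp: U'_def)
    moreover have "\<zeta> y = e' y"
      if \<zeta>: "\<zeta> x = b" "\<forall>j\<in>insert ?i (X ?i). f j \<zeta> = \<alpha>' j" for \<zeta>
    proof -
      have "\<forall>j\<in>X ?i. f j \<zeta> = \<alpha> j"
        using \<zeta>(2) X(1)[OF i(2)] by (auto simp: \<alpha>'_def)
      then have "\<forall>v\<in>S ?i \<inter> D. \<zeta> v = e v" using X_det \<zeta>(1) by blast
      moreover have "f ?i \<zeta> = a ?i" using \<zeta>(2) i(3) by (simp add: \<alpha>'_def)
      ultimately have "\<zeta> (w ?i) = \<epsilon> ?i" by (rule tgt(2)[OF i(1)])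
      then show ?thesis using False r(2)[OF y] by (simp add: e'_def)
    qed
    ultimately show ?thesis using X(2)[OF i(2)] by blast
  qed
  then have "propagated x b (3 * s + 1) D' U'"
    unfolding propagated_def using sub cards by blast
  moreover have "card (S i \<inter> D) < card (S i \<inter> D')" if i: "i \<in> G - U'" "S i \<inter> D \<noteq> {}" for i
  proof (rule psubset_card_mono)
    show "finite (S i \<inter> D')" using finite_S i by blast
    have "i \<in> H" using i by (auto simp: H_def U'_def)
    then show "S i \<inter> D \<subset> S i \<inter> D'" using tgt(1)[of i] by (auto simp: D'_def)
  qed
  ultimately show ?thesis
    by (intro that[of D' U']) (auto simp: D'_def U'_def)
qed

text \<open>A gate that meets \<open>D\<close> and stays outside for three rounds would gain a known
  variable in each and thus read four. Iterating \<open>3 * s + 1\<close> three times gives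
  \<open>27 * s + 13\<close>.\<close>

lemma propagation_three_rounds:
  assumes base: "propagated x b s D U" and irr: "irrefutable x b N" and N: "27 * s + 13 \<le> N"
  obtains D' U' where "propagated x b (27 * s + 13) D' U'"
    "\<And>i. i \<in> G \<Longrightarrow> S i \<inter> D \<noteq> {} \<Longrightarrow> i \<in> U'"
proof -
  have "3 * s + 1 \<le> N" using N by simp
  from propagation_round[OF base irr this] obtain D1 U1
    where 1: "propagated x b (3 * s + 1) D1 U1" "D \<subseteq> D1" "U \<subseteq> U1"
    "\<And>i. i \<in> G - U1 \<Longrightarrow> S i \<inter> D \<noteq> {} \<Longrightarrow> card (S i \<inter> D) < card (S i \<inter> D1)" by blast
  have "3 * (3 * s + 1) + 1 \<le> N" using N by simp
  from propagation_round[OF 1(1) irr this] obtain D2 U2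
    where 2: "propagated x b (3 * (3 * s + 1) + 1) D2 U2" "D1 \<subseteq> D2" "U1 \<subseteq> U2"
    "\<And>i. i \<in> G - U2 \<Longrightarrow> S i \<inter> D1 \<noteq> {} \<Longrightarrow> card (S i \<inter> D1) < card (S i \<inter> D2)" by blast
  have "3 * (3 * (3 * s + 1) + 1) + 1 \<le> N" using N by simp
  from propagation_round[OF 2(1) irr this] obtain D3 U3
    where 3: "propagated x b (3 * (3 * (3 * s + 1) + 1) + 1) D3 U3" "D2 \<subseteq> D3" "U2 \<subseteq> U3"
    "\<And>i. i \<in> G - U3 \<Longrightarrow> S i \<inter> D2 \<noteq> {} \<Longrightarrow> card (S i \<inter> D2) < card (S i \<inter> D3)" by blast
  have eq: "3 * (3 * (3 * s + 1) + 1) + 1 = 27 * s + 13" by simp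
  show ?thesis
  proof (rule that)
    show "propagated x b (27 * s + 13) D3 U3" using 3(1) unfolding eq .
    fix i assume i: "i \<in> G" "S i \<inter> D \<noteq> {}"
    show "i \<in> U3"
    proof (rule ccontr)
      assume "i \<notin> U3"
      then have "i \<in> G - U1" "i \<in> G - U2" "i \<in> G - U3" using i 2 3 by auto
      moreover have "S i \<inter> D1 \<noteq> {}" "S i \<inter> D2 \<noteq> {}" using i 1 2 by auto
      ultimately have "card (S i \<inter> D) < card (S i \<inter> D1)" "card (S i \<inter> D1) < card (S i \<inter> D2)"
        "card (S i \<inter> D2) < card (S i \<inter> D3)" using i 1(4) 2(4) 3(4) by auto
      moreover have "card (S i \<inter> D) \<noteq> 0" using i finite_S by auto
      moreover have "card (S i \<inter> D3) \<le> card (S i)"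
        using finite_S[OF i(1)] by (intro card_mono) auto
      ultimately show False using card_S[OF i(1)] by linarith
    qed
  qed
qed

text \<open>Three rounds from \<open>{x}\<close> absorb the gates at \<open>x\<close> and yield more
  than \<open>d\<close> known variables; three further rounds absorb all gates meeting these.
  Counting incidences gives \<open>3 * card U2 \<ge> d * d \<ge> 3 * card V\<close>, although
  \<open>card U2 < card D2 \<le> card V\<close>. The bounds on the outputs used are 13 and then
  \<open>27 * 13 + 13 = 364\<close>.\<close>

lemma literal_refutable:
  assumes deg: "\<And>v. v \<in> V \<Longrightarrow> d \<le> card {i\<in>G. v \<in> S i}"
    and d: "3 * card V \<le> d * d" and x: "x \<in> V"
  shows "\<not> irrefutable x b 364"
proof
  assume irr: "irrefutable x b 364"
  have "propagated x b 0 {x} {}"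
    unfolding propagated_def using x by (auto intro!: exI[of _ "\<lambda>_. b"])
  from propagation_three_rounds[OF this irr] obtain D1 U1 where
    1: "propagated x b 13 D1 U1" "\<And>i. i \<in> G \<Longrightarrow> S i \<inter> {x} \<noteq> {} \<Longrightarrow> i \<in> U1"
    by auto
  from propagation_three_rounds[OF 1(1) irr] obtain D2 U2 where
    2: "propagated x b 364 D2 U2" "\<And>i. i \<in> G \<Longrightarrow> S i \<inter> D1 \<noteq> {} \<Longrightarrow> i \<in> U2"
    by auto
  have U: "U1 \<subseteq> G" "U2 \<subseteq> G" "D1 \<subseteq> V" "D2 \<subseteq> V" "card D1 = card U1 + 1" "card D2 = card U2 + 1"
    using 1(1) 2(1) by (auto simp: propagated_def)
  have fin: "finite U1" "finite U2" "finite D1"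
    using U finite_G finite_V finite_subset by auto
  have "d \<le> card {i\<in>G. x \<in> S i}" using deg x by blast
  also have "\<dots> \<le> card U1" using 1(2) fin by (intro card_mono) auto
  finally have D1: "d < card D1" using U by simp
  have "d * card D1 \<le> (\<Sum>v\<in>D1. card {i\<in>G. v \<in> S i})"
    using sum_mono[of D1 "\<lambda>_. d" "\<lambda>v. card {i\<in>G. v \<in> S i}"] deg U by (auto simp: mult.commute)
  \<comment> \<open>All gates meeting \<open>D1\<close> lie in \<open>U2\<close>, so no incidence is
    lost.\<close>
  also have "\<dots> = (\<Sum>v\<in>D1. card {i\<in>U2. v \<in> S i})"
    using 2(2) U by (intro sum.cong refl arg_cong[where f = card]) auto
  also have "\<dots> = (\<Sum>i\<in>U2. card {v\<in>D1. v \<in> S i})"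
    by (rule sum_multicount_gen) (use fin in simp_all)
  also have "\<dots> \<le> (\<Sum>i\<in>U2. 3)"
  proof (rule sum_mono)
    fix i assume "i \<in> U2"
    then have i: "i \<in> G" using U by auto
    have "card {v\<in>D1. v \<in> S i} \<le> card (S i)"
      using finite_S[OF i] by (intro card_mono) auto
    then show "card {v\<in>D1. v \<in> S i} \<le> 3" using card_S[OF i] by linarith
  qed
  also have "\<dots> = 3 * card U2" by simp
  finally have "d * card D1 \<le> 3 * card U2" .
  moreover have "d * d \<le> d * card D1" using D1 by simp
  moreover have "card U2 < card V"
    using card_mono[OF finite_V U(4)] U(6) by simp
  ultimately show False using d by linarith
qed

end

section \<open>Unattainable patterns from large degree and from density\<close>

definition unattainable :: "('i \<Rightarrow> (nat \<Rightarrow> bool) \<Rightarrow> bool) \<Rightarrow> 'i set \<Rightarrow> ('i \<Rightarrow> bool) \<Rightarrow> bool" where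
  "unattainable f W \<alpha> \<longleftrightarrow> (\<forall>\<zeta>. \<exists>i\<in>W. f i \<zeta> \<noteq> \<alpha> i)"

text \<open>The value 0 of some variable is refuted first. Deleting the at most 364 outputs used
  lowers each degree by at most 364, so the value 1 can be refuted by other outputs, and the two
  prescriptions cannot conflict.\<close>

lemma (in monotone_juntas) unattainable_of_degree:
  assumes deg: "\<And>v. v \<in> V \<Longrightarrow> d + 364 \<le> card {i\<in>G. v \<in> S i}"
    and d: "3 * card V \<le> d * d" and "V \<noteq> {}"
  shows "\<exists>W \<alpha>. W \<subseteq> G \<and> card W \<le> 728 \<and> unattainable f W \<alpha>"
proof -
  obtain x where x: "x \<in> V" using \<open>V \<noteq> {}\<close> by blast
  have "\<not> irrefutable x False 364"
    by (rule literal_refutable[OF _ d x]) (use deg in force)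
  then obtain W0 \<alpha>0 where W0: "W0 \<subseteq> G" "card W0 \<le> 364"
      "\<forall>\<zeta>. \<zeta> x = False \<longrightarrow> (\<exists>i\<in>W0. f i \<zeta> \<noteq> \<alpha>0 i)"
    by (rule refutableE)
  interpret rest: monotone_juntas V "G - W0" S f
  proof
    show "f i \<xi>" if "i \<in> G - W0" "\<forall>v\<in>S i. \<zeta> v \<longrightarrow> \<xi> v" "f i \<zeta>" for i \<zeta> \<xi>
      by (rule mono[OF _ that(2,3)]) (use that(1) in simp)
    show "finite V" "finite (G - W0)" using finite_V finite_G by simp_all
    show "S i \<subseteq> V" "card (S i) \<le> 3" if "i \<in> G - W0" for i
      using that S_subset[of i] card_S[of i] by simp_all
  qed
  have "\<not> rest.irrefutable x True 364"
  proof (rule rest.literal_refutable[OF _ d x])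
    fix v assume "v \<in> V"
    have "{i\<in>G. v \<in> S i} \<subseteq> {i\<in>G - W0. v \<in> S i} \<union> W0" by auto
    then have "card {i\<in>G. v \<in> S i} \<le> card ({i\<in>G - W0. v \<in> S i} \<union> W0)"
      using finite_G finite_subset[OF W0(1)] by (intro card_mono) auto
    also have "\<dots> \<le> card {i\<in>G - W0. v \<in> S i} + card W0" by (rule card_Un_le)
    finally show "d \<le> card {i\<in>G - W0. v \<in> S i}"
      using deg[OF \<open>v \<in> V\<close>] W0(2) by linarith
  qed
  then obtain W1 \<alpha>1 where W1: "W1 \<subseteq> G - W0" "card W1 \<le> 364"
      "\<forall>\<zeta>. \<zeta> x = True \<longrightarrow> (\<exists>i\<in>W1. f i \<zeta> \<noteq> \<alpha>1 i)"
    by (rule rest.refutableE)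
  let ?\<alpha> = "\<lambda>i. if i \<in> W0 then \<alpha>0 i else \<alpha>1 i"
  have "card (W0 \<union> W1) \<le> 728" using card_Un_le[of W0 W1] W0 W1 by linarith
  moreover have "\<exists>i\<in>W0 \<union> W1. f i \<zeta> \<noteq> ?\<alpha> i" for \<zeta>
  proof (cases "\<zeta> x")
    case True
    then obtain i where "i \<in> W1" "f i \<zeta> \<noteq> \<alpha>1 i" using W1(3) by blast
    then show ?thesis using W1(1) by (intro bexI[of _ i]) auto
  next
    case False
    then obtain i where "i \<in> W0" "f i \<zeta> \<noteq> \<alpha>0 i" using W0(3) by blast
    then show ?thesis by (intro bexI[of _ i]) auto
  qed
  ultimately show ?thesis
    using W0(1) W1(1) unfolding unattainable_def
    by (intro exI[of _ "W0 \<union> W1"] exI[of _ ?\<alpha>]) auto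
qed

text \<open>Among the variable sets spanning more than \<open>d + 364\<close> gates per variable, a
  smallest one has minimum degree at least \<open>d + 364\<close>: dropping a variable of lower
  degree would preserve the inequality.\<close>

lemma (in monotone_juntas) unattainable_of_card:
  assumes m: "(d + 364) * card V < card G" and d: "3 * card V \<le> d * d"
  shows "\<exists>W \<alpha>. W \<subseteq> G \<and> card W \<le> 728 \<and> unattainable f W \<alpha>"
proof -
  define sub where "sub V' = {i\<in>G. S i \<subseteq> V'}" for V'
  define Q where "Q V' \<longleftrightarrow> V' \<subseteq> V \<and> (d + 364) * card V' < card (sub V')" for V'
  have "sub V = G" using S_subset by (auto simp: sub_def)
  then have "Q V" using m by (simp add: Q_def)
  define V' where "V' = arg_min card Q"
  have V': "Q V'" "\<And>X. Q X \<Longrightarrow> card V' \<le> card X"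
    unfolding V'_def using arg_min_natI[of Q V card] arg_min_nat_le[of Q _ card] \<open>Q V\<close> by auto
  have V'V: "V' \<subseteq> V" "finite V'" and big: "(d + 364) * card V' < card (sub V')"
    using V'(1) finite_V finite_subset by (auto simp: Q_def)
  interpret core: monotone_juntas V' "sub V'" S f
  proof
    show "f i \<xi>" if "i \<in> sub V'" "\<forall>v\<in>S i. \<zeta> v \<longrightarrow> \<xi> v" "f i \<zeta>" for i \<zeta> \<xi>
      by (rule mono[OF _ that(2,3)]) (use that(1) in \<open>simp add: sub_def\<close>)
    show "finite V'" "finite (sub V')" using V'V finite_G by (simp_all add: sub_def)
    show "S i \<subseteq> V'" "card (S i) \<le> 3" if "i \<in> sub V'" for i
      using that card_S[of i] by (simp_all add: sub_def)
  qed
  have finsub: "finite (sub X)" for X using finite_G by (simp add: sub_def)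
  show ?thesis
  proof (cases "V' = {}")
    case True
    \<comment> \<open>With no variables left, a spanned gate is constant, and the negation of its
      value is a pattern on one output.\<close>
    then obtain i where i: "i \<in> sub V'" using big by fastforce
    then have "S i = {}" using True by (simp add: sub_def)
    then have "f i \<zeta> = f i (\<lambda>_. True)" for \<zeta>
      by (intro core.determined_value i) simp
    then have "unattainable f {i} (\<lambda>j. \<not> f j (\<lambda>_. True))"
      unfolding unattainable_def by simp
    then show ?thesis using i by (intro exI[of _ "{i}"]) (auto simp: sub_def)
  next
    case False
    have "\<exists>W \<alpha>. W \<subseteq> sub V' \<and> card W \<le> 728 \<and> unattainable f W \<alpha>"
    proof (rule core.unattainable_of_degree[OF _ _ False])
      show "3 * card V' \<le> d * d"
        using d card_mono[OF finite_V V'V(1)] by linarith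
      fix v assume v: "v \<in> V'"
      have smaller: "card (V' - {v}) < card V'" using v V'V by (intro card_Diff1_less)
      show "d + 364 \<le> card {i\<in>sub V'. v \<in> S i}"
      proof (rule ccontr)
        assume low: "\<not> d + 364 \<le> card {i\<in>sub V'. v \<in> S i}"
        have "sub V' \<subseteq> sub (V' - {v}) \<union> {i\<in>sub V'. v \<in> S i}" by (auto simp: sub_def)
        then have "card (sub V') \<le> card (sub (V' - {v}) \<union> {i\<in>sub V'. v \<in> S i})"
          using finsub by (intro card_mono) auto
        also have "\<dots> \<le> card (sub (V' - {v})) + card {i\<in>sub V'. v \<in> S i}"
          by (rule card_Un_le)
        finally have "card (sub V') \<le> card (sub (V' - {v})) + card {i\<in>sub V'. v \<in> S i}" .
        moreover have "(d + 364) * card V' = (d + 364) * card (V' - {v}) + (d + 364)"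
          using card.remove[OF V'V(2) v] by (simp only: mult_Suc_right add.commute)
        ultimately have "(d + 364) * card (V' - {v}) < card (sub (V' - {v}))"
          using big low by linarith
        then have "Q (V' - {v})" using V'V by (auto simp: Q_def)
        then show False using V'(2)[of "V' - {v}"] smaller by simp
      qed
    qed
    then show ?thesis by (auto simp: sub_def)
  qed
qed

section \<open>Polynomial-time functions on trees\<close>

primrec shift_expr :: "nat \<Rightarrow> expr \<Rightarrow> expr" where
  "shift_expr k (EVar v) = EVar (k + v)"
| "shift_expr k ENil = ENil"
| "shift_expr k (ECons e f) = ECons (shift_expr k e) (shift_expr k f)"
| "shift_expr k (EHd e) = EHd (shift_expr k e)"
| "shift_expr k (ETl e) = ETl (shift_expr k e)"

primrec shift_com :: "nat \<Rightarrow> com \<Rightarrow> com" where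
  "shift_com k Skip = Skip"
| "shift_com k (Assign v e) = Assign (k + v) (shift_expr k e)"
| "shift_com k (Seq p q) = Seq (shift_com k p) (shift_com k q)"
| "shift_com k (Cond e p q) = Cond (shift_expr k e) (shift_com k p) (shift_com k q)"
| "shift_com k (While e p) = While (shift_expr k e) (shift_com k p)"

text \<open>The lower \<open>k\<close> registers belong to the caller, the others to a program
  shifted by \<open>k\<close>.\<close>

definition frame :: "nat \<Rightarrow> store \<Rightarrow> store \<Rightarrow> store" where
  "frame k r s = (\<lambda>v. if v < k then r v else s (v - k))"

lemma frame_upd: "frame k r (s(v := d)) = (frame k r s)(k + v := d)"
  by (auto simp: frame_def fun_eq_iff)

lemma eval_shift_expr [simp]: "eval_expr (shift_expr k e) (frame k r s) = eval_expr e s"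
  by (induction e) (auto simp: frame_def)

lemma cost_shift_expr [simp]: "cost_expr (shift_expr k e) = cost_expr e"
  by (induction e) auto

lemma exec_shift_com:
  "exec p s t s' \<Longrightarrow> exec (shift_com k p) (frame k r s) t (frame k r s')"
proof (induction rule: exec.induct)
  case (Skip s)
  show ?case using exec.Skip by simp
next
  case (Assign v e s)
  then show ?case
    using exec.Assign[of "k + v" "shift_expr k e" "frame k r s"]
    by (simp only: shift_com.simps frame_upd cost_shift_expr eval_shift_expr)
next
  case (CondTrue e s p t s' q)
  then show ?case
    using exec.CondTrue[of "shift_expr k e" "frame k r s" "shift_com k p" t] by simp
next
  case (CondFalse e s q t s' p)
  then show ?case
    using exec.CondFalse[of "shift_expr k e" "frame k r s" "shift_com k q" t] by simp
next
  case (WhileTrue e s p t s' u s'')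
  then show ?case
    using exec.WhileTrue[of "shift_expr k e" "frame k r s" "shift_com k p" t "frame k r s'" u]
    by simp
next
  case (WhileFalse e s p)
  then show ?case
    using exec.WhileFalse[of "shift_expr k e" "frame k r s" "shift_com k p"] by simp
qed (auto intro: exec.intros)

text \<open>An upper bound in place of the exact time allows branches and loop rounds to be charged
  uniformly.\<close>

definition runs :: "com \<Rightarrow> store \<Rightarrow> nat \<Rightarrow> store \<Rightarrow> bool" where
  "runs p s T s' \<longleftrightarrow> (\<exists>t\<le>T. exec p s t s')"

lemma runs_mono: "runs p s T s' \<Longrightarrow> T \<le> U \<Longrightarrow> runs p s U s'"
  unfolding runs_def by (meson le_trans)

lemma runs_Assign:
  "s' = s(v := eval_expr e s) \<Longrightarrow> 1 + cost_expr e \<le> T \<Longrightarrow> runs (Assign v e) s T s'"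
  unfolding runs_def using exec.Assign by blast

lemma runs_Seq: "runs p s T s' \<Longrightarrow> runs q s' U s'' \<Longrightarrow> runs (Seq p q) s (T + U) s''"
  unfolding runs_def by (meson add_mono exec.Seq)

lemma runs_CondTrue:
  assumes "eval_expr e s \<noteq> Leaf" "runs p s T s'"
  shows "runs (Cond e p q) s (1 + cost_expr e + T) s'"
  using assms unfolding runs_def by (meson add_left_mono exec.CondTrue)

lemma runs_CondFalse:
  assumes "eval_expr e s = Leaf" "runs q s T s'"
  shows "runs (Cond e p q) s (1 + cost_expr e + T) s'"
  using assms unfolding runs_def by (meson add_left_mono exec.CondFalse)

lemma runs_WhileTrue:
  assumes "eval_expr e s \<noteq> Leaf" "runs p s T s'" "runs (While e p) s' U s''"
  shows "runs (While e p) s (1 + cost_expr e + T + U) s''"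
  using assms unfolding runs_def by (meson add_left_mono add_mono exec.WhileTrue)

lemma runs_WhileFalse:
  "eval_expr e s = Leaf \<Longrightarrow> runs (While e p) s (1 + cost_expr e) s"
  unfolding runs_def using exec.WhileFalse by blast

text \<open>Subprograms are called on register 3, above three registers of the caller.\<close>

definition regs :: "data \<Rightarrow> data \<Rightarrow> data \<Rightarrow> data \<Rightarrow> store" where
  "regs a b c d = (\<lambda>_. Leaf)(0 := a, 1 := b, 2 := c, 3 := d)"

abbreviation input_store :: "data \<Rightarrow> store" where
  "input_store x \<equiv> regs x Leaf Leaf Leaf"

lemma input_store_eq: "input_store x = (\<lambda>_. Leaf)(0 := x)"
  by (auto simp: regs_def)

lemma regs_simps [simp]:
  "regs a b c d 0 = a" "regs a b c d (Suc 0) = b" "regs a b c d 2 = c" "regs a b c d 3 = d"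
  "(regs a b c d)(0 := y) = regs y b c d"
  "(regs a b c d)(Suc 0 := y) = regs a y c d"
  "(regs a b c d)(2 := y) = regs a b y d"
  "(regs a b c d)(3 := y) = regs a b c y"
  by (auto simp: regs_def fun_eq_iff)

lemma runs_call:
  assumes "runs p (input_store x) T (input_store y)"
  shows "runs (shift_com 3 p) (regs a b c x) T (regs a b c y)"
proof -
  have "frame 3 (regs a b c Leaf) (input_store z) = regs a b c z" for z
    by (auto simp: frame_def regs_def fun_eq_iff)
  then show ?thesis
    using assms exec_shift_com[of p _ _ _ 3 "regs a b c Leaf"] unfolding runs_def by metis
qed

section \<open>Closure properties of polynomial-time functions\<close>

lemma poly_nat_mono: "x \<le> y \<Longrightarrow> poly (q :: nat poly) x \<le> poly q y"
  by (induction q) (auto intro: add_mono mult_mono)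

text \<open>With closure rules for this predicate, time bounds can be written as arithmetic terms
  without exhibiting coefficients.\<close>

definition polyfun :: "(nat \<Rightarrow> nat) \<Rightarrow> bool" where
  "polyfun f \<longleftrightarrow> (\<exists>q. \<forall>n. f n = poly q n)"

lemma polyfun_intros:
  "polyfun (\<lambda>n. k)"
  "polyfun (\<lambda>n. n)"
  "polyfun f \<Longrightarrow> polyfun g \<Longrightarrow> polyfun (\<lambda>n. f n + g n)"
  "polyfun f \<Longrightarrow> polyfun g \<Longrightarrow> polyfun (\<lambda>n. f n * g n)"
  "polyfun f \<Longrightarrow> polyfun (\<lambda>n. poly q (f n))"
proof -
  show "polyfun (\<lambda>n. k)" unfolding polyfun_def by (rule exI[of _ "[:k:]"]) simp
  show "polyfun (\<lambda>n. n)" unfolding polyfun_def by (rule exI[of _ "[:0, 1:]"]) simp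
  show "polyfun f \<Longrightarrow> polyfun g \<Longrightarrow> polyfun (\<lambda>n. f n + g n)"
    unfolding polyfun_def by (metis poly_add)
  show "polyfun f \<Longrightarrow> polyfun g \<Longrightarrow> polyfun (\<lambda>n. f n * g n)"
    unfolding polyfun_def by (metis poly_mult)
  show "polyfun f \<Longrightarrow> polyfun (\<lambda>n. poly q (f n))"
    unfolding polyfun_def by (metis poly_pcompose)
qed

text \<open>The output size must be bounded separately, since trees may share subtrees and double in
  size at every step.\<close>

definition ptime :: "(data \<Rightarrow> data) \<Rightarrow> bool" where
  "ptime f \<longleftrightarrow> (\<exists>p q. \<forall>x. runs p (input_store x) (poly q (size x)) (input_store (f x)) \<and>
     size (f x) \<le> poly q (size x))"

lemma ptimeI:
  assumes "\<And>x. runs p (input_store x) (T (size x)) (input_store (f x))" "polyfun T"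
    and "\<And>x. size (f x) \<le> S (size x)" "polyfun S"
  shows "ptime f"
proof -
  obtain q where q: "\<And>n. T n + S n = poly q n"
    using polyfun_intros(3)[OF assms(2,4)] unfolding polyfun_def by blast
  have "runs p (input_store x) (poly q (size x)) (input_store (f x))" for x
    by (rule runs_mono[OF assms(1)]) (metis q le_add1)
  moreover have "size (f x) \<le> poly q (size x)" for x
    using assms(3)[of x] q[of "size x"] by linarith
  ultimately show ?thesis unfolding ptime_def by blast
qed

lemma ptimeE:
  assumes "ptime f"
  obtains p q where "\<And>x. runs p (input_store x) (poly q (size x)) (input_store (f x))"
    and "\<And>x. size (f x) \<le> poly q (size x)"
  using assms unfolding ptime_def by blast

lemma size_hd_data: "size (hd_data x) \<le> size x" by (cases x) auto
lemma size_tl_data: "size (tl_data x) \<le> size x" by (cases x) auto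

lemma ptime_id: "ptime (\<lambda>x. x)"
  by (rule ptimeI[where p = "Assign 0 (EVar 0)" and T = "\<lambda>_. 2" and S = "\<lambda>n. n"])
    (auto intro!: runs_Assign polyfun_intros)

lemma ptime_Leaf: "ptime (\<lambda>x. Leaf)"
  by (rule ptimeI[where p = "Assign 0 ENil" and T = "\<lambda>_. 2" and S = "\<lambda>n. n"])
    (auto intro!: runs_Assign polyfun_intros)

lemma ptime_hd_data: "ptime hd_data"
  by (rule ptimeI[where p = "Assign 0 (EHd (EVar 0))" and T = "\<lambda>_. 3" and S = "\<lambda>n. n"])
    (auto intro!: runs_Assign polyfun_intros size_hd_data)

lemma ptime_tl_data: "ptime tl_data"
  by (rule ptimeI[where p = "Assign 0 (ETl (EVar 0))" and T = "\<lambda>_. 3" and S = "\<lambda>n. n"])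
    (auto intro!: runs_Assign polyfun_intros size_tl_data)

text \<open>A program witnessing \<open>ptime\<close> leaves every register but 0 at
  \<open>Leaf\<close>, so sequencing composes. The output bound for \<open>f\<close> makes the time
  of the second program polynomial in the original input.\<close>

lemma ptime_comp:
  assumes "ptime g" "ptime f"
  shows "ptime (\<lambda>x. g (f x))"
proof -
  from \<open>ptime f\<close> obtain p q where pq:
    "\<And>x. runs p (input_store x) (poly q (size x)) (input_store (f x))"
    "\<And>x. size (f x) \<le> poly q (size x)" by (rule ptimeE) blast
  from \<open>ptime g\<close> obtain p' q' where pq':
    "\<And>x. runs p' (input_store x) (poly q' (size x)) (input_store (g x))"
    "\<And>x. size (g x) \<le> poly q' (size x)" by (rule ptimeE) blast
  have le: "poly q' (size (f x)) \<le> poly q' (poly q (size x))" for x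
    by (intro poly_nat_mono pq)
  show ?thesis
  proof (rule ptimeI)
    show "runs (Seq p p') (input_store x) (poly q (size x) + poly q' (poly q (size x)))
      (input_store (g (f x)))" for x
      by (rule runs_Seq[OF pq(1)], rule runs_mono[OF pq'(1) le])
    show "size (g (f x)) \<le> poly q' (poly q (size x))" for x
      using pq'(2) le by (rule order_trans)
  qed (intro polyfun_intros)+
qed

text \<open>Register 0 keeps the input while both programs run in shifted registers, and register 1
  saves the first result.\<close>

lemma ptime_Node:
  assumes "ptime f" "ptime g"
  shows "ptime (\<lambda>x. Node (f x) (g x))"
proof -
  from \<open>ptime f\<close> obtain p q where pq:
    "\<And>x. runs p (input_store x) (poly q (size x)) (input_store (f x))"
    "\<And>x. size (f x) \<le> poly q (size x)" by (rule ptimeE) blast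
  from \<open>ptime g\<close> obtain p' q' where pq':
    "\<And>x. runs p' (input_store x) (poly q' (size x)) (input_store (g x))"
    "\<And>x. size (g x) \<le> poly q' (size x)" by (rule ptimeE) blast
  let ?p = "Seq (Assign 3 (EVar 0)) (Seq (shift_com 3 p) (Seq (Assign 1 (EVar 3))
    (Seq (Assign 3 (EVar 0)) (Seq (shift_com 3 p') (Seq (Assign 0 (ECons (EVar 1) (EVar 3)))
    (Seq (Assign 1 ENil) (Assign 3 ENil)))))))"
  show ?thesis
  proof (rule ptimeI)
    fix x
    show "runs ?p (input_store x)
      (2 + (poly q (size x) + (2 + (2 + (poly q' (size x) + (4 + (2 + 2)))))))
      (input_store (Node (f x) (g x)))"
      apply (rule runs_Seq[where s' = "regs x Leaf Leaf x"], rule runs_Assign, simp, simp)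
      apply (rule runs_Seq[where s' = "regs x Leaf Leaf (f x)"], rule runs_call, rule pq)
      apply (rule runs_Seq[where s' = "regs x (f x) Leaf (f x)"], rule runs_Assign, simp, simp)
      apply (rule runs_Seq[where s' = "regs x (f x) Leaf x"], rule runs_Assign, simp, simp)
      apply (rule runs_Seq[where s' = "regs x (f x) Leaf (g x)"], rule runs_call, rule pq')
      apply (rule runs_Seq[where s' = "regs (Node (f x) (g x)) (f x) Leaf (g x)"],
          rule runs_Assign, simp, simp)
      apply (rule runs_Seq[where s' = "regs (Node (f x) (g x)) Leaf Leaf (g x)"],
          rule runs_Assign, simp, simp)
      apply (rule runs_Assign, simp, simp)
      done
    show "size (Node (f x) (g x)) \<le> poly q (size x) + poly q' (size x) + 1"
      using pq(2)[of x] pq'(2)[of x] by simp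
  qed (intro polyfun_intros)+
qed

text \<open>The test runs in shifted registers, which leaves the input in register 0; once register
  3 is cleared, the chosen program runs unshifted.\<close>

lemma ptime_If:
  assumes "ptime h" "ptime f" "ptime g"
  shows "ptime (\<lambda>x. if h x \<noteq> Leaf then f x else g x)"
proof -
  from \<open>ptime h\<close> obtain p0 q0 where pq0:
    "\<And>x. runs p0 (input_store x) (poly q0 (size x)) (input_store (h x))"
    "\<And>x. size (h x) \<le> poly q0 (size x)" by (rule ptimeE) blast
  from \<open>ptime f\<close> obtain p q where pq:
    "\<And>x. runs p (input_store x) (poly q (size x)) (input_store (f x))"
    "\<And>x. size (f x) \<le> poly q (size x)" by (rule ptimeE) blast
  from \<open>ptime g\<close> obtain p' q' where pq':
    "\<And>x. runs p' (input_store x) (poly q' (size x)) (input_store (g x))"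
    "\<And>x. size (g x) \<le> poly q' (size x)" by (rule ptimeE) blast
  let ?p = "Seq (Assign 3 (EVar 0)) (Seq (shift_com 3 p0)
    (Seq (Cond (EVar 3) (Seq (Assign 3 ENil) p) (Seq (Assign 3 ENil) p')) Skip))"
  show ?thesis
  proof (rule ptimeI)
    fix x
    have skip: "runs Skip s 1 s" for s
      unfolding runs_def using exec.Skip by blast
    have "runs (Cond (EVar 3) (Seq (Assign 3 ENil) p) (Seq (Assign 3 ENil) p'))
      (regs x Leaf Leaf (h x)) (4 + poly q (size x) + poly q' (size x))
      (input_store (if h x \<noteq> Leaf then f x else g x))"
    proof (cases "h x = Leaf")
      case True
      have "runs (Cond (EVar 3) (Seq (Assign 3 ENil) p) (Seq (Assign 3 ENil) p'))
        (regs x Leaf Leaf (h x)) (1 + cost_expr (EVar 3) + (2 + poly q' (size x)))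
        (input_store (g x))"
        by (rule runs_CondFalse, simp add: True,
          rule runs_Seq[where s' = "input_store x"], rule runs_Assign, simp, simp, rule pq')
      then show ?thesis using True by (auto elim: runs_mono)
    next
      case False
      have "runs (Cond (EVar 3) (Seq (Assign 3 ENil) p) (Seq (Assign 3 ENil) p'))
        (regs x Leaf Leaf (h x)) (1 + cost_expr (EVar 3) + (2 + poly q (size x)))
        (input_store (f x))"
        by (rule runs_CondTrue, simp add: False,
          rule runs_Seq[where s' = "input_store x"], rule runs_Assign, simp, simp, rule pq)
      then show ?thesis using False by (auto elim: runs_mono)
    qed
    then show "runs ?p (input_store x)
      (2 + (poly q0 (size x) + ((4 + poly q (size x) + poly q' (size x)) + 1)))
      (input_store (if h x \<noteq> Leaf then f x else g x))"
      by (intro runs_Seq[where s' = "regs x Leaf Leaf x"]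
          runs_Seq[where s' = "regs x Leaf Leaf (h x)"] runs_Seq[OF _ skip] runs_call pq0)
        (auto intro!: runs_Assign)
    show "size (if h x \<noteq> Leaf then f x else g x) \<le> poly q (size x) + poly q' (size x)"
      using pq(2)[of x] pq'(2)[of x] by simp
  qed (intro polyfun_intros)+
qed

text \<open>Iteration along an encoded list. The body receives the whole remaining suffix, which can
  represent a position and not only an element.\<close>

primrec loop :: "(data \<Rightarrow> data \<Rightarrow> data) \<Rightarrow> data \<Rightarrow> data \<Rightarrow> data" where
  "loop F Leaf acc = acc"
| "loop F (Node a b) acc = loop F b (F (Node a b) acc)"

lemma size_loop:
  assumes "\<And>s acc. size s \<le> L \<Longrightarrow> size (F s acc) \<le> size acc + R"
    and "size l \<le> L"
  shows "size (loop F l acc) \<le> size acc + size l * R"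
  using assms(2)
proof (induction l arbitrary: acc)
  case (Node a b)
  have "size (loop F b (F (Node a b) acc)) \<le> size (F (Node a b) acc) + size b * R"
    using Node by simp
  also have "\<dots> \<le> size acc + R + size b * R"
    using assms(1)[of "Node a b" acc] Node.prems by simp
  also have "\<dots> \<le> size acc + size (Node a b) * R"
    by (simp add: algebra_simps)
  finally show ?case by simp
qed simp

abbreviation arg1 :: "data \<Rightarrow> data" where "arg1 z \<equiv> hd_data z"
abbreviation arg2 :: "data \<Rightarrow> data" where "arg2 z \<equiv> hd_data (tl_data z)"
abbreviation arg3 :: "data \<Rightarrow> data" where "arg3 z \<equiv> tl_data (tl_data z)"

text \<open>The accumulator is required to grow additively; with a merely polynomial bound on the
  body it could double in every round.\<close>

lemma ptime_loop_aux:
  assumes F: "ptime (\<lambda>z. F (arg1 z) (arg2 z) (arg3 z))"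
    and bound: "\<And>s acc x. size (F s acc x) \<le> size acc + poly r (size s + size x)"
  shows "ptime (\<lambda>z. loop (\<lambda>s acc. F s acc (arg3 z)) (arg1 z) (arg2 z))"
proof -
  from F obtain p q where pq:
    "\<And>z. runs p (input_store z) (poly q (size z)) (input_store (F (arg1 z) (arg2 z) (arg3 z)))"
    "\<And>z. size (F (arg1 z) (arg2 z) (arg3 z)) \<le> poly q (size z)" by (rule ptimeE) blast
  \<comment> \<open>Register 0 holds the remaining list, register 1 the accumulator and register 2
    the parameter; they are packed into one tree for the call.\<close>
  define body where "body = Seq (Assign 3 (ECons (EVar 0) (ECons (EVar 1) (EVar 2))))
    (Seq (shift_com 3 p) (Seq (Assign 1 (EVar 3)) (Seq (Assign 3 ENil) (Assign 0 (ETl (EVar 0))))))"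
  have run_body: "runs body (regs (Node a b) acc x Leaf)
      (6 + (poly q (size (Node a b) + size acc + size x + 2) + (2 + (2 + 3))))
      (regs b (F (Node a b) acc x) x Leaf)" for a b acc x
  proof -
    let ?z = "Node (Node a b) (Node acc x)"
    have "runs p (input_store ?z) (poly q (size (Node a b) + size acc + size x + 2))
      (input_store (F (Node a b) acc x))"
      using pq(1)[of ?z] by (simp add: ac_simps)
    note call = runs_call[OF this]
    show ?thesis
      unfolding body_def
      apply (rule runs_Seq[where s' = "regs (Node a b) acc x ?z"])
       apply (rule runs_Assign, simp, simp)
      apply (rule runs_Seq[where s' = "regs (Node a b) acc x (F (Node a b) acc x)"])
       apply (rule call)
      apply (rule runs_Seq[where s' = "regs (Node a b) (F (Node a b) acc x) x (F (Node a b) acc x)"])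
       apply (rule runs_Assign, simp, simp)
      apply (rule runs_Seq[where s' = "regs (Node a b) (F (Node a b) acc x) x Leaf"])
       apply (rule runs_Assign, simp, simp)
      apply (rule runs_Assign, simp, simp)
      done
  qed
  \<comment> \<open>\<open>M\<close> bounds the accumulator throughout, since the invariant budgets
    one increment per remaining cell. The constant 15 is 13 for the body and 2 for the test.\<close>
  have run_while: "runs (While (EVar 0) body) (regs l acc x Leaf)
      (2 + size l * (15 + poly q (L + M + size x + 2)))
      (regs Leaf (loop (\<lambda>s acc. F s acc x) l acc) x Leaf)"
    if "size l \<le> L" "size acc + size l * poly r (L + size x) \<le> M" for l acc x L M
    using that
  proof (induction l arbitrary: acc)
    case Leaf
    show ?case
      using runs_WhileFalse[of "EVar 0" "regs Leaf acc x Leaf" body] by (simp add: numeral_2_eq_2)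
  next
    case (Node a b)
    let ?B = "15 + poly q (L + M + size x + 2)"
    let ?acc = "F (Node a b) acc x"
    have "poly r (size (Node a b) + size x) \<le> poly r (L + size x)"
      using Node.prems by (intro poly_nat_mono) simp
    then have "size ?acc \<le> size acc + poly r (L + size x)"
      using bound[of "Node a b" acc x] by linarith
    then have "size ?acc + size b * poly r (L + size x) \<le> M"
      using Node.prems(2) by (simp add: algebra_simps)
    then have rest: "runs (While (EVar 0) body) (regs b ?acc x Leaf) (2 + size b * ?B)
      (regs Leaf (loop (\<lambda>s acc. F s acc x) b ?acc) x Leaf)"
      using Node by simp
    have "poly q (size (Node a b) + size acc + size x + 2) \<le> poly q (L + M + size x + 2)"
      using Node.prems by (intro poly_nat_mono) simp
    then have first: "runs body (regs (Node a b) acc x Leaf) (13 + poly q (L + M + size x + 2))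
      (regs b ?acc x Leaf)"
      by (intro runs_mono[OF run_body]) simp
    have "runs (While (EVar 0) body) (regs (Node a b) acc x Leaf)
      (1 + cost_expr (EVar 0) + (13 + poly q (L + M + size x + 2)) + (2 + size b * ?B))
      (regs Leaf (loop (\<lambda>s acc. F s acc x) b ?acc) x Leaf)"
      by (rule runs_WhileTrue[OF _ first rest]) simp
    then show ?case
      by (rule_tac runs_mono) (auto simp: algebra_simps)
  qed
  let ?p = "Seq (Assign 1 (EHd (ETl (EVar 0)))) (Seq (Assign 2 (ETl (ETl (EVar 0))))
    (Seq (Assign 0 (EHd (EVar 0))) (Seq (While (EVar 0) body)
    (Seq (Assign 0 (EVar 1)) (Seq (Assign 1 ENil) (Assign 2 ENil))))))"
  let ?M = "\<lambda>n. n + n * poly r (n + n)"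
  let ?W = "\<lambda>n. 2 + n * (15 + poly q (n + ?M n + n + 2))"
  show ?thesis
  proof (rule ptimeI)
    fix z
    let ?n = "size z" and ?l = "arg1 z" and ?a = "arg2 z" and ?x = "arg3 z"
    let ?r = "loop (\<lambda>s acc. F s acc ?x) ?l ?a"
    have sizes: "size ?l \<le> ?n" "size ?a \<le> ?n" "size ?x \<le> ?n"
      by (meson size_hd_data size_tl_data order_trans)+
    have R: "poly r (?n + size ?x) \<le> poly r (?n + ?n)"
      using sizes by (intro poly_nat_mono) simp
    have "size ?a + size ?l * poly r (?n + size ?x) \<le> ?M ?n"
      using sizes R by (intro add_mono mult_mono) auto
    then have "runs (While (EVar 0) body) (regs ?l ?a ?x Leaf)
      (2 + size ?l * (15 + poly q (?n + ?M ?n + size ?x + 2))) (regs Leaf ?r ?x Leaf)"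
      using sizes by (intro run_while) auto
    moreover have "2 + size ?l * (15 + poly q (?n + ?M ?n + size ?x + 2)) \<le> ?W ?n"
      using sizes by (intro add_mono mult_mono poly_nat_mono) auto
    ultimately have w: "runs (While (EVar 0) body) (regs ?l ?a ?x Leaf) (?W ?n)
      (regs Leaf ?r ?x Leaf)" by (rule runs_mono)
    show "runs ?p (input_store z) (4 + (4 + (3 + (?W ?n + (2 + (2 + 2)))))) (input_store ?r)"
      apply (rule runs_Seq[where s' = "regs z ?a Leaf Leaf"], rule runs_Assign, simp, simp)
      apply (rule runs_Seq[where s' = "regs z ?a ?x Leaf"], rule runs_Assign, simp, simp)
      apply (rule runs_Seq[where s' = "regs ?l ?a ?x Leaf"], rule runs_Assign, simp, simp)
      apply (rule runs_Seq[OF w])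
      apply (rule runs_Seq[where s' = "regs ?r ?r ?x Leaf"], rule runs_Assign, simp, simp)
      apply (rule runs_Seq[where s' = "regs ?r Leaf ?x Leaf"], rule runs_Assign, simp, simp)
      apply (rule runs_Assign, simp, simp)
      done
    have "size ?r \<le> size ?a + size ?l * poly r (?n + ?n)"
    proof (rule size_loop)
      show "size ?l \<le> ?n" by (rule sizes)
      fix s acc :: data assume "size s \<le> ?n"
      then have "poly r (size s + size ?x) \<le> poly r (?n + ?n)"
        using sizes by (intro poly_nat_mono) simp
      then show "size (F s acc ?x) \<le> size acc + poly r (?n + ?n)"
        using bound[of s acc ?x] by linarith
    qed
    also have "\<dots> \<le> ?M ?n"
      using sizes by (intro add_mono mult_mono) auto
    finally show "size ?r \<le> ?M ?n" .
  qed (intro polyfun_intros)+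
qed

lemma ptime_loop:
  assumes F: "ptime (\<lambda>z. F (arg1 z) (arg2 z) (arg3 z))"
    and bound: "\<And>s acc x. size (F s acc x) \<le> size acc + poly r (size s + size x)"
    and "ptime l" "ptime a"
  shows "ptime (\<lambda>x. loop (\<lambda>s acc. F s acc x) (l x) (a x))"
  using ptime_comp[OF ptime_loop_aux[OF F bound] ptime_Node[OF \<open>ptime l\<close> ptime_Node[OF \<open>ptime a\<close> ptime_id]]]
  by simp

lemmas ptime_hd = ptime_comp[OF ptime_hd_data]
lemmas ptime_tl = ptime_comp[OF ptime_tl_data]
lemmas ptime_basics = ptime_id ptime_Leaf ptime_Node ptime_If ptime_hd ptime_tl

text \<open>With \<open>Leaf\<close> read as false, this is bounded existential quantification.\<close>

definition find_suffix :: "(data \<Rightarrow> data) \<Rightarrow> data \<Rightarrow> data" where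
  "find_suffix F l = loop (\<lambda>s acc. if acc \<noteq> Leaf then acc else F s) l Leaf"

lemma ptime_find_suffix:
  assumes F: "ptime (\<lambda>z. F (hd_data z) (tl_data z))" and "ptime l"
  shows "ptime (\<lambda>x. find_suffix (\<lambda>s. F s x) (l x))"
proof -
  from F obtain q where q: "\<And>z. size (F (hd_data z) (tl_data z)) \<le> poly q (size z)"
    by (rule ptimeE) blast
  have "ptime (\<lambda>z. Node (arg1 z) (arg3 z))" by (intro ptime_basics)
  from ptime_comp[OF F this] have "ptime (\<lambda>z. F (arg1 z) (arg3 z))" by simp
  then have "ptime (\<lambda>z. if arg2 z \<noteq> Leaf then arg2 z else F (arg1 z) (arg3 z))"
    by (intro ptime_If ptime_hd ptime_tl ptime_id)
  \<comment> \<open>Composition with \<open>[:1, 1:]\<close> accounts for the extra cell of the pair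
    \<open>Node s x\<close>.\<close>
  moreover have "size (if acc \<noteq> Leaf then acc else F s x) \<le>
      size acc + poly (pcompose q [:1, 1:]) (size s + size x)" for s acc x
    using q[of "Node s x"] by (simp add: poly_pcompose ac_simps)
  ultimately show ?thesis
    unfolding find_suffix_def by (rule ptime_loop[OF _ _ \<open>ptime l\<close> ptime_Leaf])
qed

definition map_suffix_rev :: "(data \<Rightarrow> data) \<Rightarrow> data \<Rightarrow> data" where
  "map_suffix_rev F l = loop (\<lambda>s acc. Node (F s) acc) l Leaf"

lemma ptime_map_suffix_rev:
  assumes F: "ptime (\<lambda>z. F (hd_data z) (tl_data z))" and "ptime l"
  shows "ptime (\<lambda>x. map_suffix_rev (\<lambda>s. F s x) (l x))"
proof -
  from F obtain q where q: "\<And>z. size (F (hd_data z) (tl_data z)) \<le> poly q (size z)"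
    by (rule ptimeE) blast
  have "ptime (\<lambda>z. Node (arg1 z) (arg3 z))" by (intro ptime_basics)
  from ptime_comp[OF F this] have "ptime (\<lambda>z. F (arg1 z) (arg3 z))" by simp
  then have "ptime (\<lambda>z. Node (F (arg1 z) (arg3 z)) (arg2 z))"
    by (intro ptime_Node ptime_hd ptime_tl ptime_id)
  moreover have "size (Node (F s x) acc) \<le>
      size acc + poly (pcompose q [:1, 1:] + 1) (size s + size x)" for s acc x
    using q[of "Node s x"] by (simp add: poly_pcompose ac_simps)
  ultimately show ?thesis
    unfolding map_suffix_rev_def by (rule ptime_loop[OF _ _ \<open>ptime l\<close> ptime_Leaf])
qed

section \<open>Exhaustive search as a polynomial-time function\<close>

text \<open>Loop bodies take a pair of suffix and input; this treats the parts depending on the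
  input alone.\<close>

lemma ptime_env: "ptime f \<Longrightarrow> ptime (\<lambda>z. f (tl_data z))"
  by (rule ptime_comp[OF _ ptime_tl_data])

abbreviation true_data :: data where
  "true_data \<equiv> Node Leaf Leaf"

definition drop_len :: "data \<Rightarrow> data \<Rightarrow> data" where
  "drop_len a b = loop (\<lambda>s acc. tl_data acc) a b"

text \<open>The machine has no equality test, but comparing lengths decides equality of unary
  numbers and of suffixes of one list.\<close>

definition eq_len :: "data \<Rightarrow> data \<Rightarrow> data" where
  "eq_len a b =
     (if drop_len a b \<noteq> Leaf then Leaf else if drop_len b a \<noteq> Leaf then Leaf else true_data)"

definition member :: "data \<Rightarrow> data \<Rightarrow> data" where
  "member d l = find_suffix (\<lambda>s. eq_len d (hd_data s)) l"

text \<open>A missing variable reads as false, so a gate with fewer than three variables is treated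
  as having upper digits 0.\<close>

definition head_member :: "data \<Rightarrow> data \<Rightarrow> data" where
  "head_member vs P = (if vs \<noteq> Leaf then member (hd_data vs) P else Leaf)"

text \<open>The variables are the binary digits of the table position: if true, the third skips four
  entries, the second two and the first one.\<close>

definition gate_val :: "data \<Rightarrow> data \<Rightarrow> data" where
  "gate_val g P =
    (let vs = hd_data g; t = tl_data g;
       t4 = (if head_member (tl_data (tl_data vs)) P \<noteq> Leaf
         then tl_data (tl_data (tl_data (tl_data t))) else t);
       t2 = (if head_member (tl_data vs) P \<noteq> Leaf then tl_data (tl_data t4) else t4)
     in hd_data (if head_member vs P \<noteq> Leaf then tl_data t2 else t2))"

definition differ :: "data \<Rightarrow> data \<Rightarrow> data" where
  "differ a b = (if a \<noteq> Leaf then if b \<noteq> Leaf then Leaf else true_data else b)"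

text \<open>A position in the list of gates is represented by the suffix starting there, so that
  \<open>hd_data\<close> yields the gate and \<open>eq_len\<close> compares positions. \<open>T\<close> lists the constrained outputs,
  \<open>A\<close> the outputs that are to be 1, and \<open>P\<close> the input variables that are 1.\<close>

definition mismatch :: "data \<Rightarrow> data \<Rightarrow> data \<Rightarrow> data" where
  "mismatch T A P =
     find_suffix (\<lambda>s. differ (gate_val (hd_data (hd_data s)) P) (member (hd_data s) A)) T"

text \<open>Up to \<open>k\<close> further variables are guessed to be 1. For a unary number
  \<open>N\<close>, the tails of its nonempty suffixes are exactly the smaller numbers, which
  enumerates the variables. Since \<open>k\<close> is not part of the input, the loops are nested to
  constant depth.\<close>

primrec sat :: "nat \<Rightarrow> data \<Rightarrow> data \<Rightarrow> data \<Rightarrow> data \<Rightarrow> data" where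
  "sat 0 T A P N = (if mismatch T A P \<noteq> Leaf then Leaf else true_data)"
| "sat (Suc k) T A P N = (if sat k T A P N \<noteq> Leaf then true_data else
     find_suffix (\<lambda>s. sat k T A (Node (tl_data s) P) N) N)"

text \<open>The outer pass only copies elements, undoing the reversal caused by the inner
  one.\<close>

definition indicator_list :: "data \<Rightarrow> data \<Rightarrow> data" where
  "indicator_list A Gs = map_suffix_rev hd_data (map_suffix_rev (\<lambda>s. member s A) Gs)"

text \<open>Each level keeps the pattern or constrains one more output, with or without marking it
  as 1. The wrapper \<open>Node Leaf\<close> prevents a success from reading as false.\<close>

primrec search :: "nat \<Rightarrow> nat \<Rightarrow> data \<Rightarrow> data \<Rightarrow> data \<Rightarrow> data" where
  "search r 0 T A x =
     (if sat r T A Leaf (hd_data x) \<noteq> Leaf then Leaf else Node Leaf (indicator_list A (tl_data x)))"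
| "search r (Suc k) T A x = (if search r k T A x \<noteq> Leaf then search r k T A x else
     find_suffix (\<lambda>s. if search r k (Node s T) A x \<noteq> Leaf then search r k (Node s T) A x
       else search r k (Node s T) (Node s A) x) (tl_data x))"

lemma ptime_drop_len: "ptime f \<Longrightarrow> ptime g \<Longrightarrow> ptime (\<lambda>x. drop_len (f x) (g x))"
  unfolding drop_len_def
  by (rule ptime_loop[where F = "\<lambda>s acc x. tl_data acc" and r = 0])
    (simp_all add: size_tl_data, intro ptime_tl ptime_hd ptime_id)

lemma ptime_eq_len: "ptime f \<Longrightarrow> ptime g \<Longrightarrow> ptime (\<lambda>x. eq_len (f x) (g x))"
  unfolding eq_len_def by (intro ptime_If ptime_drop_len ptime_Leaf ptime_Node)

lemma ptime_member: "ptime f \<Longrightarrow> ptime g \<Longrightarrow> ptime (\<lambda>x. member (f x) (g x))"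
  unfolding member_def
  by (rule ptime_find_suffix[where F = "\<lambda>s x. eq_len (f x) (hd_data s)"])
    (intro ptime_eq_len ptime_env ptime_hd ptime_id)

lemma ptime_head_member: "ptime f \<Longrightarrow> ptime g \<Longrightarrow> ptime (\<lambda>x. head_member (f x) (g x))"
  unfolding head_member_def by (intro ptime_If ptime_member ptime_hd ptime_Leaf)

lemma ptime_gate_val: "ptime f \<Longrightarrow> ptime g \<Longrightarrow> ptime (\<lambda>x. gate_val (f x) (g x))"
  unfolding gate_val_def Let_def
  by (intro ptime_hd ptime_If ptime_head_member ptime_tl)

lemma ptime_differ: "ptime f \<Longrightarrow> ptime g \<Longrightarrow> ptime (\<lambda>x. differ (f x) (g x))"
  unfolding differ_def by (intro ptime_If ptime_Leaf ptime_Node)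

lemma ptime_mismatch:
  assumes "ptime f" "ptime g" "ptime h"
  shows "ptime (\<lambda>x. mismatch (f x) (g x) (h x))"
  unfolding mismatch_def
  by (rule ptime_find_suffix[where F = "\<lambda>s x. differ (gate_val (hd_data (hd_data s)) (h x))
        (member (hd_data s) (g x))"])
    (intro ptime_differ ptime_gate_val ptime_member ptime_env ptime_hd ptime_id assms)+

text \<open>The induction is generalized over the argument functions because the loop body calls the
  previous level on data extracted from a pair of suffix and input.\<close>

lemma ptime_sat:
  assumes "ptime f" "ptime g" "ptime h" "ptime n"
  shows "ptime (\<lambda>x. sat k (f x) (g x) (h x) (n x))"
  using assms
proof (induction k arbitrary: f g h n)
  case 0
  then show ?case
    unfolding sat.simps by (intro ptime_If ptime_mismatch ptime_Leaf ptime_Node)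
next
  case (Suc k)
  have "ptime (\<lambda>z. sat k (f (tl_data z)) (g (tl_data z))
      (Node (tl_data (hd_data z)) (h (tl_data z))) (n (tl_data z)))"
    by (rule Suc.IH) (intro ptime_env ptime_Node ptime_tl ptime_hd ptime_id Suc.prems)+
  from ptime_find_suffix[where F = "\<lambda>s x. sat k (f x) (g x) (Node (tl_data s) (h x)) (n x)",
      OF this \<open>ptime n\<close>]
  show ?case
    unfolding sat.simps by (intro ptime_If Suc.IH Suc.prems ptime_Leaf ptime_Node)
qed

lemma ptime_indicator_list:
  assumes "ptime f" "ptime g"
  shows "ptime (\<lambda>x. indicator_list (f x) (g x))"
proof -
  have "ptime (\<lambda>x. map_suffix_rev (\<lambda>s. member s (f x)) (g x))"
    by (rule ptime_map_suffix_rev[where F = "\<lambda>s x. member s (f x)"])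
      (intro ptime_member ptime_env ptime_hd ptime_id assms)+
  then show ?thesis
    unfolding indicator_list_def
    by (rule ptime_map_suffix_rev[where F = "\<lambda>s x. hd_data s", rotated])
      (intro ptime_hd ptime_id)
qed

lemma ptime_search:
  assumes "ptime f" "ptime g" "ptime h"
  shows "ptime (\<lambda>x. search r k (f x) (g x) (h x))"
  using assms
proof (induction k arbitrary: f g h)
  case 0
  then show ?case
    unfolding search.simps by (intro ptime_If ptime_sat ptime_indicator_list ptime_hd ptime_tl ptime_Leaf ptime_Node)
next
  case (Suc k)
  let ?T = "\<lambda>z. Node (hd_data z) (f (tl_data z))"
  let ?A = "\<lambda>z. Node (hd_data z) (g (tl_data z))"
  have "ptime ?T" "ptime ?A"
    by (intro ptime_env ptime_Node ptime_hd ptime_id Suc.prems)+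
  note IH = Suc.IH[OF this(1) ptime_env[OF \<open>ptime g\<close>] ptime_env[OF \<open>ptime h\<close>]]
    Suc.IH[OF this ptime_env[OF \<open>ptime h\<close>]]
  note body = ptime_If[OF IH(1) IH]
  from ptime_find_suffix[where F = "\<lambda>s x. if search r k (Node s (f x)) (g x) (h x) \<noteq> Leaf
      then search r k (Node s (f x)) (g x) (h x)
      else search r k (Node s (f x)) (Node s (g x)) (h x)", OF body ptime_tl[OF \<open>ptime h\<close>]]
  show ?case
    unfolding search.simps by (intro ptime_If Suc.IH Suc.prems)
qed

subsection \<open>Correctness of the search\<close>

lemma enc_list_simps [simp]:
  "enc_list e [] = Leaf" "enc_list e (x # xs) = Node (e x) (enc_list e xs)"
  by (simp_all add: enc_list_def)

lemma enc_list_eq_Leaf [simp]: "enc_list e xs = Leaf \<longleftrightarrow> xs = []"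
  by (cases xs) auto

lemma enc_bool_simps [simp]: "enc_bool b \<noteq> Leaf \<longleftrightarrow> b" "enc_bool b = Leaf \<longleftrightarrow> \<not> b"
  by (auto simp: enc_bool_def)

lemma tl_data_enc_list: "tl_data (enc_list e xs) = enc_list e (tl xs)"
  by (cases xs) auto

lemma hd_data_enc_list: "xs \<noteq> [] \<Longrightarrow> hd_data (enc_list e xs) = e (hd xs)"
  by (cases xs) auto

lemma hd_data_enc_list_drop: "i < length xs \<Longrightarrow> hd_data (enc_list e (drop i xs)) = e (xs ! i)"
  by (simp add: hd_data_enc_list hd_drop_conv_nth)

lemma find_suffix_simps [simp]:
  "find_suffix F Leaf = Leaf"
  "find_suffix F (Node a b) = (if F (Node a b) \<noteq> Leaf then F (Node a b) else find_suffix F b)"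
proof -
  have stable: "acc \<noteq> Leaf \<Longrightarrow> loop (\<lambda>s acc. if acc \<noteq> Leaf then acc else F s) l acc = acc" for l acc
    by (induction l) auto
  show "find_suffix F Leaf = Leaf"
    "find_suffix F (Node a b) = (if F (Node a b) \<noteq> Leaf then F (Node a b) else find_suffix F b)"
    using stable[of "F (Node a b)" b] by (auto simp: find_suffix_def)
qed

lemma find_suffix_enc_list:
  "find_suffix F (enc_list e xs) \<noteq> Leaf \<longleftrightarrow> (\<exists>i<length xs. F (enc_list e (drop i xs)) \<noteq> Leaf)"
  by (induction xs) (auto simp: Ex_less_Suc2)

lemma find_suffix_enc_listE:
  assumes "find_suffix F (enc_list e xs) \<noteq> Leaf"
  obtains i where "i < length xs" "find_suffix F (enc_list e xs) = F (enc_list e (drop i xs))"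
proof -
  have "\<exists>i<length xs. find_suffix F (enc_list e xs) = F (enc_list e (drop i xs))"
    using assms by (induction xs) (auto simp: Ex_less_Suc2)
  then show ?thesis using that by blast
qed

lemma find_suffix_enc_list_elem:
  "find_suffix (\<lambda>s. F (hd_data s)) (enc_list e xs) \<noteq> Leaf \<longleftrightarrow> (\<exists>x\<in>set xs. F (e x) \<noteq> Leaf)"
  by (induction xs) auto

lemma drop_len_enc_list:
  "drop_len (enc_list e xs) (enc_list e' ys) = enc_list e' (drop (length xs) ys)"
  unfolding drop_len_def
  by (induction xs arbitrary: ys) (auto simp: tl_data_enc_list drop_Suc)

lemma eq_len_enc_list: "eq_len (enc_list e xs) (enc_list e' ys) = enc_bool (length xs = length ys)"
  by (auto simp: eq_len_def drop_len_enc_list enc_bool_def)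

lemma eq_len_cases: "eq_len a b = Leaf \<or> eq_len a b = true_data"
  by (simp add: eq_len_def)

text \<open>An equation and not just an equivalence: these truth values enter the output string and
  must be exact encodings.\<close>

lemma member_enc_list:
  "member d (enc_list e xs) = enc_bool (\<exists>x\<in>set xs. eq_len d (e x) \<noteq> Leaf)"
proof -
  have "member d (enc_list e xs) \<in> {Leaf, true_data}"
    unfolding member_def using eq_len_cases[of d] by (induction xs) auto
  moreover have "member d (enc_list e xs) \<noteq> Leaf \<longleftrightarrow> (\<exists>x\<in>set xs. eq_len d (e x) \<noteq> Leaf)"
    unfolding member_def by (rule find_suffix_enc_list_elem)
  ultimately show ?thesis by (auto simp: enc_bool_def)
qed

lemma member_enc_nat: "member (enc_nat v) (enc_list enc_nat P) = enc_bool (v \<in> set P)"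
  by (auto simp: member_enc_list enc_nat_def eq_len_enc_list)

lemma map_suffix_rev_enc_list:
  "map_suffix_rev F (enc_list e xs) =
     enc_list (\<lambda>d. d) (rev (map (\<lambda>i. F (enc_list e (drop i xs))) [0..<length xs]))"
proof -
  have "loop (\<lambda>s acc. Node (F s) acc) (enc_list e xs) (enc_list (\<lambda>d. d) ys) =
    enc_list (\<lambda>d. d) (rev (map (\<lambda>i. F (enc_list e (drop i xs))) [0..<length xs]) @ ys)" for ys
  proof (induction xs arbitrary: ys)
    case (Cons x xs)
    have "[0..<length (x # xs)] = 0 # map Suc [0..<length xs]"
      by (simp add: map_Suc_upt upt_conv_Cons del: upt_Suc)
    then show ?case
      using Cons.IH[of "F (enc_list e (x # xs)) # ys"] by (simp add: comp_def del: upt_Suc)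
  qed simp
  from this[of "[]"] show ?thesis by (simp add: map_suffix_rev_def)
qed

text \<open>Gates act here on total assignments, as in \<open>monotone_juntas\<close>, instead of on
  bit lists of fixed length.\<close>

definition gate_fun :: "gate \<Rightarrow> (nat \<Rightarrow> bool) \<Rightarrow> bool" where
  "gate_fun g \<zeta> = snd g ! horner_sum of_bool 2 (map \<zeta> (fst g))"

lemma eval_gate_eq: "eval_gate g x = gate_fun g ((!) x)"
  by (simp add: eval_gate_def gate_fun_def)

lemma gate_fun_cong: "(\<And>v. v \<in> set (fst g) \<Longrightarrow> \<zeta> v = \<xi> v) \<Longrightarrow> gate_fun g \<zeta> = gate_fun g \<xi>"
  unfolding gate_fun_def by (simp cong: map_cong)

lemma gate_val_enc_gate:
  assumes "local_gate 3 n g"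
  shows "gate_val (enc_gate g) (enc_list enc_nat P) = enc_bool (gate_fun g (\<lambda>v. v \<in> set P))"
proof -
  obtain vs t where g: "g = (vs, t)" by fastforce
  have len: "length vs \<le> 3" "length t = 2 ^ length vs"
    using assms by (auto simp: local_gate_def g)
  have hm: "head_member (enc_list enc_nat ws) (enc_list enc_nat P) \<noteq> Leaf \<longleftrightarrow>
      ws \<noteq> [] \<and> hd ws \<in> set P" for ws
    by (cases ws) (auto simp: head_member_def member_enc_nat)
  have val: "hd_data (enc_list enc_bool ys) = enc_bool (ys ! 0)" if "ys \<noteq> []" for ys
    using that by (simp add: hd_data_enc_list hd_conv_nth)
  consider "vs = []" | a where "vs = [a]" | a b where "vs = [a, b]" | a b c where "vs = [a, b, c]"
    using len(1) by (metis One_nat_def Suc_leI le_SucE length_0_conv length_Suc_conv less_Suc_eq_le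
        numeral_3_eq_3 le_zero_eq)
  then show ?thesis
  proof cases
    case 1
    then show ?thesis using len
      by (auto simp: g gate_val_def enc_gate_def gate_fun_def Let_def hm tl_data_enc_list val
          head_member_def length_Suc_conv)
  next
    case (2 a)
    then obtain t0 t1 where "t = [t0, t1]" using len
      by (auto simp: length_Suc_conv numeral_eq_Suc)
    then show ?thesis using 2
      by (auto simp: g gate_val_def enc_gate_def gate_fun_def Let_def member_enc_nat
          head_member_def)
  next
    case (3 a b)
    then obtain t0 t1 t2 t3 where "t = [t0, t1, t2, t3]" using len
      by (auto simp: length_Suc_conv numeral_eq_Suc)
    then show ?thesis using 3
      by (auto simp: g gate_val_def enc_gate_def gate_fun_def Let_def member_enc_nat
          head_member_def numeral_eq_Suc)
  next
    case (4 a b c)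
    then obtain t0 t1 t2 t3 t4 t5 t6 t7 where "t = [t0, t1, t2, t3, t4, t5, t6, t7]" using len
      by (auto simp: length_Suc_conv numeral_eq_Suc)
    then show ?thesis using 4
      by (auto simp: g gate_val_def enc_gate_def gate_fun_def Let_def member_enc_nat
          head_member_def numeral_eq_Suc)
  qed
qed

abbreviation suffix :: "gate list \<Rightarrow> nat \<Rightarrow> data" where
  "suffix gs i \<equiv> enc_list enc_gate (drop i gs)"

definition agrees :: "gate list \<Rightarrow> nat list \<Rightarrow> nat list \<Rightarrow> (nat \<Rightarrow> bool) \<Rightarrow> bool" where
  "agrees gs T A \<zeta> \<longleftrightarrow> (\<forall>i\<in>set T. gate_fun (gs ! i) \<zeta> = (i \<in> set A))"

context
  fixes n :: nat and gs :: "gate list"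
  assumes local: "\<And>g. g \<in> set gs \<Longrightarrow> local_gate 3 n g"
begin

text \<open>Suffixes starting at different positions have different lengths, so positions are told
  apart even if a gate occurs twice.\<close>

lemma member_suffix:
  assumes "i < length gs" "set A \<subseteq> {..<length gs}"
  shows "member (suffix gs i) (enc_list (suffix gs) A) = enc_bool (i \<in> set A)"
proof -
  have "eq_len (suffix gs i) (suffix gs j) \<noteq> Leaf \<longleftrightarrow> i = j" if "j \<in> set A" for j
    using assms that by (auto simp: eq_len_enc_list)
  then show ?thesis by (auto simp: member_enc_list)
qed

lemma indicator_list_eq:
  assumes "set A \<subseteq> {..<length gs}"
  shows "indicator_list (enc_list (suffix gs) A) (enc_list enc_gate gs) =
     enc_list enc_bool (map (\<lambda>i. i \<in> set A) [0..<length gs])"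
proof -
  let ?bs = "map (\<lambda>i. enc_bool (i \<in> set A)) [0..<length gs]"
  have "map (\<lambda>i. member (suffix gs i) (enc_list (suffix gs) A)) [0..<length gs] = ?bs"
    using member_suffix[OF _ assms] by simp
  then have "indicator_list (enc_list (suffix gs) A) (enc_list enc_gate gs) =
      map_suffix_rev hd_data (enc_list (\<lambda>d. d) (rev ?bs))"
    unfolding indicator_list_def map_suffix_rev_enc_list[of _ enc_gate] by (simp only:)
  also have "\<dots> = enc_list (\<lambda>d. d)
      (rev (map (\<lambda>i. hd_data (enc_list (\<lambda>d. d) (drop i (rev ?bs)))) [0..<length (rev ?bs)]))"
    by (rule map_suffix_rev_enc_list)
  also have "map (\<lambda>i. hd_data (enc_list (\<lambda>d. d) (drop i (rev ?bs)))) [0..<length (rev ?bs)] =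
      map (\<lambda>i. rev ?bs ! i) [0..<length (rev ?bs)]"
    by (intro map_cong refl hd_data_enc_list_drop) simp
  also have "\<dots> = rev ?bs" by (rule map_nth)
  also have "enc_list (\<lambda>d. d) (rev (rev ?bs)) = enc_list enc_bool (map (\<lambda>i. i \<in> set A) [0..<length gs])"
    by (simp add: enc_list_def foldr_map comp_def)
  finally show ?thesis .
qed

lemma mismatch_iff:
  assumes "set T \<subseteq> {..<length gs}" "set A \<subseteq> {..<length gs}"
  shows "mismatch (enc_list (suffix gs) T) (enc_list (suffix gs) A) (enc_list enc_nat P) \<noteq> Leaf
    \<longleftrightarrow> \<not> agrees gs T A (\<lambda>v. v \<in> set P)"
proof -
  have differ: "differ (enc_bool a) (enc_bool b) \<noteq> Leaf \<longleftrightarrow> a \<noteq> b" for a b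
    by (auto simp: differ_def)
  have gate: "gate_val (hd_data (suffix gs i)) (enc_list enc_nat P) =
      enc_bool (gate_fun (gs ! i) (\<lambda>v. v \<in> set P))" if "i \<in> set T" for i
  proof -
    have "i < length gs" using that assms by auto
    then show ?thesis
      using gate_val_enc_gate[OF local[of "gs ! i"]] by (simp add: hd_data_enc_list_drop)
  qed
  show ?thesis
    unfolding mismatch_def find_suffix_enc_list_elem[where F = "\<lambda>d. differ (gate_val (hd_data d)
        (enc_list enc_nat P)) (member d (enc_list (suffix gs) A))"] agrees_def
    using assms(1) gate member_suffix[OF _ assms(2)] differ by (auto simp: subset_iff)
qed

lemma tl_data_suffix_enc_nat:
  "tl_data (enc_list (\<lambda>_. Leaf) [i..<n]) = enc_nat (n - Suc i)"
proof -
  have "enc_list (\<lambda>_. Leaf) xs = enc_list (\<lambda>_. Leaf) ys" if "length xs = length ys"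
    for xs ys :: "nat list"
    using that by (induction rule: list_induct2) auto
  from this[of "tl [i..<n]" "[0..<n - Suc i]"] show ?thesis
    by (simp add: tl_data_enc_list enc_nat_def)
qed

lemma sat_iff:
  assumes "set T \<subseteq> {..<length gs}" "set A \<subseteq> {..<length gs}"
  shows "sat k (enc_list (suffix gs) T) (enc_list (suffix gs) A) (enc_list enc_nat P) (enc_nat n)
      \<noteq> Leaf \<longleftrightarrow>
    (\<exists>Q. length Q \<le> k \<and> set Q \<subseteq> {..<n} \<and> agrees gs T A (\<lambda>v. v \<in> set Q \<union> set P))"
proof (induction k arbitrary: P)
  case 0
  show ?case using mismatch_iff[OF assms, of P] by simp
next
  case (Suc k)
  let ?sat = "\<lambda>P. sat k (enc_list (suffix gs) T) (enc_list (suffix gs) A) P (enc_nat n)"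
  have "find_suffix (\<lambda>s. ?sat (Node (tl_data s) (enc_list enc_nat P))) (enc_nat n) \<noteq> Leaf \<longleftrightarrow>
      (\<exists>i<n. ?sat (enc_list enc_nat ((n - Suc i) # P)) \<noteq> Leaf)"
    by (subst (2) enc_nat_def, subst find_suffix_enc_list) (simp add: tl_data_suffix_enc_nat)
  \<comment> \<open>The map taking \<open>i\<close> to \<open>n - Suc i\<close> is an involution on
    the numbers below \<open>n\<close>.\<close>
  also have "\<dots> \<longleftrightarrow> (\<exists>v<n. ?sat (enc_list enc_nat (v # P)) \<noteq> Leaf)"
  proof (intro iffI; elim exE conjE)
    fix v assume v: "v < n" "?sat (enc_list enc_nat (v # P)) \<noteq> Leaf"
    then have "n - Suc v < n" "n - Suc (n - Suc v) = v" by auto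
    then show "\<exists>i<n. ?sat (enc_list enc_nat ((n - Suc i) # P)) \<noteq> Leaf" using v(2) by metis
  next
    fix i assume i: "i < n" "?sat (enc_list enc_nat ((n - Suc i) # P)) \<noteq> Leaf"
    then have "n - Suc i < n" by simp
    then show "\<exists>v<n. ?sat (enc_list enc_nat (v # P)) \<noteq> Leaf" using i(2) by blast
  qed
  finally have "sat (Suc k) (enc_list (suffix gs) T) (enc_list (suffix gs) A) (enc_list enc_nat P)
      (enc_nat n) \<noteq> Leaf \<longleftrightarrow>
      ?sat (enc_list enc_nat P) \<noteq> Leaf \<or> (\<exists>v<n. ?sat (enc_list enc_nat (v # P)) \<noteq> Leaf)"
    by simp
  also have "\<dots> \<longleftrightarrow>
    (\<exists>Q. length Q \<le> Suc k \<and> set Q \<subseteq> {..<n} \<and> agrees gs T A (\<lambda>v. v \<in> set Q \<union> set P))"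
    (is "?L \<longleftrightarrow> ?R")
  proof
    assume ?L
    then show ?R
    proof
      assume "?sat (enc_list enc_nat P) \<noteq> Leaf"
      then show ?R unfolding Suc.IH using le_SucI by blast
    next
      assume "\<exists>v<n. ?sat (enc_list enc_nat (v # P)) \<noteq> Leaf"
      then obtain v Q where "v < n" "length Q \<le> k" "set Q \<subseteq> {..<n}"
        "agrees gs T A (\<lambda>u. u \<in> set Q \<union> set (v # P))" unfolding Suc.IH by blast
      then show ?R by (intro exI[of _ "v # Q"]) auto
    qed
  next
    assume ?R
    then obtain Q where Q: "length Q \<le> Suc k" "set Q \<subseteq> {..<n}"
      "agrees gs T A (\<lambda>v. v \<in> set Q \<union> set P)" by blast
    show ?L
    proof (cases Q)
      case Nil
      then have "?sat (enc_list enc_nat P) \<noteq> Leaf" unfolding Suc.IH using Q by (intro exI[of _ "[]"]) simp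
      then show ?thesis ..
    next
      case (Cons v Q')
      then have "?sat (enc_list enc_nat (v # P)) \<noteq> Leaf"
        unfolding Suc.IH using Q by (intro exI[of _ Q']) auto
      moreover have "v < n" using Q Cons by simp
      ultimately show ?thesis by blast
    qed
  qed
  finally show ?case .
qed

text \<open>Only the at most \<open>3 * length T\<close> variables read by the gates in \<open>T\<close> matter.\<close>

lemma sat_iff_ex_agrees:
  assumes T: "set T \<subseteq> {..<length gs}" "set A \<subseteq> {..<length gs}" and k: "3 * length T \<le> k"
  shows "sat k (enc_list (suffix gs) T) (enc_list (suffix gs) A) Leaf (enc_nat n) \<noteq> Leaf \<longleftrightarrow>
    (\<exists>\<zeta>. agrees gs T A \<zeta>)"
proof -
  have "sat k (enc_list (suffix gs) T) (enc_list (suffix gs) A) Leaf (enc_nat n) \<noteq> Leaf \<longleftrightarrow>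
      (\<exists>Q. length Q \<le> k \<and> set Q \<subseteq> {..<n} \<and> agrees gs T A (\<lambda>v. v \<in> set Q))"
    using sat_iff[OF T, of k "[]"] by simp
  also have "\<dots> \<longleftrightarrow> (\<exists>\<zeta>. agrees gs T A \<zeta>)"
  proof
    assume "\<exists>\<zeta>. agrees gs T A \<zeta>"
    then obtain \<zeta> where \<zeta>: "agrees gs T A \<zeta>" ..
    \<comment> \<open>Setting all other variables to 0 changes nothing that a gate in
      \<open>T\<close> reads.\<close>
    define Q where "Q = filter \<zeta> (concat (map (\<lambda>i. fst (gs ! i)) T))"
    have loc: "local_gate 3 n (gs ! i)" if "i \<in> set T" for i
      using that T by (intro local nth_mem) auto
    have "length (concat (map (\<lambda>i. fst (gs ! i)) T)) \<le> 3 * length T"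
      using loc by (induction T) (auto simp: local_gate_def intro: add_mono)
    then have "length Q \<le> k"
      using k length_filter_le[of \<zeta> "concat (map (\<lambda>i. fst (gs ! i)) T)"] unfolding Q_def by (meson le_trans)
    moreover have "set Q \<subseteq> {..<n}" using loc by (auto simp: Q_def local_gate_def)
    moreover have "gate_fun (gs ! i) (\<lambda>v. v \<in> set Q) = gate_fun (gs ! i) \<zeta>" if "i \<in> set T" for i
      using that by (intro gate_fun_cong) (auto simp: Q_def)
    then have "agrees gs T A (\<lambda>v. v \<in> set Q)" using \<zeta> by (simp add: agrees_def)
    ultimately show "\<exists>Q. length Q \<le> k \<and> set Q \<subseteq> {..<n} \<and> agrees gs T A (\<lambda>v. v \<in> set Q)" by blast
  qed blast
  finally show ?thesis .
qed

abbreviation instance_data :: data where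
  "instance_data \<equiv> Node (enc_nat n) (enc_list enc_gate gs)"

text \<open>A non-\<open>Leaf\<close> result is passed up unchanged from a bottom call whose pattern
  failed the \<open>sat\<close> test; each level adds at most one output.\<close>

lemma search_sound:
  assumes "search r k (enc_list (suffix gs) T) (enc_list (suffix gs) A) instance_data \<noteq> Leaf"
    and "set T \<subseteq> {..<length gs}" "set A \<subseteq> {..<length gs}"
  shows "\<exists>T' A'. length T' \<le> length T + k \<and> set T' \<subseteq> {..<length gs} \<and> set A' \<subseteq> {..<length gs} \<and>
    sat r (enc_list (suffix gs) T') (enc_list (suffix gs) A') Leaf (enc_nat n) = Leaf \<and>
    search r k (enc_list (suffix gs) T) (enc_list (suffix gs) A) instance_data =
      Node Leaf (indicator_list (enc_list (suffix gs) A') (enc_list enc_gate gs))"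
  using assms
proof (induction k arbitrary: T A)
  case 0
  then show ?case by (intro exI[of _ T] exI[of _ A]) (auto split: if_splits)
next
  case (Suc k)
  let ?s = "\<lambda>T A. search r k (enc_list (suffix gs) T) (enc_list (suffix gs) A) instance_data"
  let ?F = "\<lambda>s. if search r k (Node s (enc_list (suffix gs) T)) (enc_list (suffix gs) A)
      instance_data \<noteq> Leaf
    then search r k (Node s (enc_list (suffix gs) T)) (enc_list (suffix gs) A) instance_data
    else search r k (Node s (enc_list (suffix gs) T)) (Node s (enc_list (suffix gs) A))
      instance_data"
  let ?r = "search r (Suc k) (enc_list (suffix gs) T) (enc_list (suffix gs) A) instance_data"
  \<comment> \<open>The pattern handed to the recursive call that delivers the result.\<close>
  obtain T1 A1 where 1: "?r = ?s T1 A1" "length T1 \<le> length T + 1"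
    "set T1 \<subseteq> {..<length gs}" "set A1 \<subseteq> {..<length gs}"
  proof (cases "?s T A = Leaf")
    case True
    then have r: "?r = find_suffix ?F (enc_list enc_gate gs)" by simp
    with Suc.prems(1) have "find_suffix ?F (enc_list enc_gate gs) \<noteq> Leaf" by simp
    then obtain i where i: "i < length gs" "find_suffix ?F (enc_list enc_gate gs) = ?F (suffix gs i)"
      by (rule find_suffix_enc_listE)
    have "?r = ?s (i # T) A \<or> ?r = ?s (i # T) (i # A)"
      unfolding r i(2) by simp
    then show ?thesis
      using that[of "i # T" A] that[of "i # T" "i # A"] Suc.prems i(1) by auto
  next
    case False
    then show ?thesis using that[of T A] Suc.prems by simp
  qed
  have "?s T1 A1 \<noteq> Leaf" using Suc.prems(1) 1(1) by simp
  from Suc.IH[OF this 1(3,4)] obtain T' A' where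
    "length T' \<le> length T1 + k" "set T' \<subseteq> {..<length gs}" "set A' \<subseteq> {..<length gs}"
    "sat r (enc_list (suffix gs) T') (enc_list (suffix gs) A') Leaf (enc_nat n) = Leaf"
    "?s T1 A1 = Node Leaf (indicator_list (enc_list (suffix gs) A') (enc_list enc_gate gs))"
    by blast
  then show ?case
    using 1(1,2) by (intro exI[of _ T'] exI[of _ A'] conjI) simp_all
qed

text \<open>A failed search has tried every pattern on at most \<open>k\<close> outputs. Since
  outputs are put in front of \<open>T\<close>, the last element of \<open>W\<close> is the one
  chosen first; the branch that adds nothing covers patterns shorter than \<open>k\<close>.\<close>

lemma search_complete:
  assumes "search r k (enc_list (suffix gs) T) (enc_list (suffix gs) A) instance_data = Leaf"
    and "length W \<le> k" "set W \<subseteq> {..<length gs}"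
  shows "sat r (enc_list (suffix gs) (W @ T)) (enc_list (suffix gs) (filter a W @ A)) Leaf
    (enc_nat n) \<noteq> Leaf"
  using assms
proof (induction k arbitrary: T A W)
  case 0
  then show ?case by (simp split: if_splits)
next
  case (Suc k)
  let ?F = "\<lambda>s. if search r k (Node s (enc_list (suffix gs) T)) (enc_list (suffix gs) A)
      instance_data \<noteq> Leaf
    then search r k (Node s (enc_list (suffix gs) T)) (enc_list (suffix gs) A) instance_data
    else search r k (Node s (enc_list (suffix gs) T)) (Node s (enc_list (suffix gs) A))
      instance_data"
  have skip: "search r k (enc_list (suffix gs) T) (enc_list (suffix gs) A) instance_data = Leaf"
    and rest: "find_suffix ?F (enc_list enc_gate gs) = Leaf"
    using Suc.prems(1) by (simp_all split: if_splits)
  show ?case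
  proof (cases W rule: rev_cases)
    case Nil
    then show ?thesis using Suc.IH[OF skip, of W] by simp
  next
    case (snoc W' i)
    then have i: "i < length gs" using Suc.prems by simp
    let ?s = "\<lambda>A. search r k (enc_list (suffix gs) (i # T)) (enc_list (suffix gs) A) instance_data"
    have "?F (suffix gs i) = Leaf"
      using iffD2[OF find_suffix_enc_list[of ?F enc_gate gs], OF exI[of _ i]] rest i by blast
    then have "?s A = Leaf" "?s (i # A) = Leaf" by (auto split: if_splits)
    then have "?s (filter a [i] @ A) = Leaf" by simp
    from Suc.IH[OF this, of W'] show ?thesis using snoc Suc.prems by simp
  qed
qed

end

section \<open>Small obstructions in circuits\<close>

lemma gate_fun_mono:
  assumes g: "local_gate 3 n g" "monotone_gate n g"
    and le: "\<forall>v\<in>set (fst g). \<zeta> v \<longrightarrow> \<xi> v" and "gate_fun g \<zeta>"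
  shows "gate_fun g \<xi>"
proof -
  \<comment> \<open>The assignments are comparable only on the variables of the gate; cutting them
    to 0 elsewhere makes the bit lists comparable everywhere.\<close>
  define restr where "restr \<chi> = map (\<lambda>v. \<chi> v \<and> v \<in> set (fst g)) [0..<n]" for \<chi> :: "nat \<Rightarrow> bool"
  have vars: "set (fst g) \<subseteq> {..<n}" using g(1) by (simp add: local_gate_def)
  have eval: "eval_gate g (restr \<chi>) = gate_fun g \<chi>" for \<chi>
    unfolding eval_gate_eq using vars by (intro gate_fun_cong) (auto simp: restr_def)
  have "list_all2 (\<le>) (restr \<zeta>) (restr \<xi>)"
    using le by (auto simp: restr_def list_all2_conv_all_nth)
  moreover have "restr \<zeta> \<in> bits n" "restr \<xi> \<in> bits n" by (simp_all add: restr_def bits_def)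
  ultimately have "eval_gate g (restr \<zeta>) \<le> eval_gate g (restr \<xi>)"
    using g(2) by (simp add: monotone_gate_def)
  then show ?thesis using \<open>gate_fun g \<zeta>\<close> by (simp add: eval)
qed

text \<open>If all patterns on the first \<open>n + 1\<close> outputs occurred, \<open>2 ^ n\<close>
  inputs would produce \<open>2 ^ (n + 1)\<close> patterns.\<close>

lemma unattainable_pigeonhole:
  assumes "\<And>g. g \<in> set gs \<Longrightarrow> local_gate 3 n g" and "n < length gs"
  shows "\<exists>\<alpha>. unattainable (\<lambda>i. gate_fun (gs ! i)) {..n} \<alpha>"
proof (rule ccontr)
  assume contra: "\<not> ?thesis"
  define \<Phi> where "\<Phi> X = {i\<in>{..n}. gate_fun (gs ! i) (\<lambda>v. v \<in> X)}" for X
  have "A \<in> \<Phi> ` Pow {..<n}" if A: "A \<subseteq> {..n}" for A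
  proof -
    from contra have "\<not> unattainable (\<lambda>i. gate_fun (gs ! i)) {..n} (\<lambda>i. i \<in> A)" by simp
    then obtain \<zeta> where \<zeta>: "\<forall>i\<le>n. gate_fun (gs ! i) \<zeta> = (i \<in> A)"
      by (auto simp: unattainable_def)
    have "gate_fun (gs ! i) (\<lambda>v. v \<in> {v\<in>{..<n}. \<zeta> v}) = gate_fun (gs ! i) \<zeta>" if "i \<le> n" for i
      using assms(1)[of "gs ! i"] assms(2) that
      by (intro gate_fun_cong) (auto simp: local_gate_def subset_iff)
    then have "\<Phi> {v\<in>{..<n}. \<zeta> v} = A" using \<zeta> A by (auto simp: \<Phi>_def)
    then show ?thesis by blast
  qed
  then have "Pow {..n} \<subseteq> \<Phi> ` Pow {..<n}" by blast
  then have "card (Pow {..n}) \<le> card (Pow {..<n})" by (intro surj_card_le) simp_all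
  then show False by (simp add: card_Pow)
qed

definition small_obstruction :: "nat \<Rightarrow> circuit \<Rightarrow> bool" where
  "small_obstruction K C \<longleftrightarrow> (\<exists>W \<alpha>. W \<subseteq> {..<num_outputs C} \<and> card W \<le> K \<and>
     unattainable (\<lambda>i. gate_fun (gates C ! i)) W \<alpha>)"

lemma small_obstruction_dense:
  assumes C: "monotone_NC0 3 C" and "(d + 364) * num_inputs C < num_outputs C"
    and "3 * num_inputs C \<le> d * d"
  shows "small_obstruction 728 C"
proof -
  let ?gs = "gates C"
  have C': "local_gate 3 (num_inputs C) (?gs ! i)" "monotone_gate (num_inputs C) (?gs ! i)"
    if "i < length ?gs" for i
    using C that by (auto simp: monotone_NC0_def)
  interpret monotone_juntas "{..<num_inputs C}" "{..<length ?gs}" "\<lambda>i. set (fst (?gs ! i))"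
    "\<lambda>i. gate_fun (?gs ! i)"
  proof
    fix i assume "i \<in> {..<length ?gs}"
    then have i: "i < length ?gs" by simp
    show "set (fst (?gs ! i)) \<subseteq> {..<num_inputs C}"
      using C'(1)[OF i] by (simp add: local_gate_def)
    show "card (set (fst (?gs ! i))) \<le> 3"
      using C'(1)[OF i] card_length[of "fst (?gs ! i)"] by (simp add: local_gate_def)
    show "gate_fun (?gs ! i) \<xi>"
      if "\<forall>v\<in>set (fst (?gs ! i)). \<zeta> v \<longrightarrow> \<xi> v" "gate_fun (?gs ! i) \<zeta>" for \<zeta> \<xi>
      using gate_fun_mono[OF C'[OF i] that] .
  qed simp_all
  from unattainable_of_card[of d] assms(2,3) show ?thesis
    by (simp add: small_obstruction_def)
qed

text \<open>For inputs up to the threshold \<open>n0\<close> counting gives an obstruction on at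
  most \<open>n0 + 1\<close> outputs; beyond it the density argument applies with \<open>d\<close>
  close to \<open>c * n\<close>.\<close>

lemma ex_small_obstruction:
  fixes c :: real
  assumes "c > 0"
  obtains K where "\<And>C. monotone_NC0 3 C \<Longrightarrow> real (num_outputs C) > c * real (num_inputs C) ^ 2 \<Longrightarrow>
    num_outputs C > num_inputs C \<Longrightarrow> small_obstruction K C"
proof -
  \<comment> \<open>Above \<open>n0\<close> one has \<open>c * n \<ge> 730\<close>, so subtracting
    \<open>365 = 364 + 1\<close> leaves at least half of \<open>c * n\<close>, and
    \<open>c ^ 2 * n \<ge> 12\<close>, so that \<open>(c * n / 2) ^ 2 \<ge> 3 * n\<close>.\<close>
  define n0 where "n0 = nat \<lceil>730 / c + 12 / c ^ 2\<rceil>"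
  define K where "K = max 728 (n0 + 1)"
  have K: "small_obstruction K C" if "small_obstruction k C" "k \<le> K" for k C
    using that unfolding small_obstruction_def by (meson le_trans)
  have "small_obstruction K C" if C: "monotone_NC0 3 C"
    "real (num_outputs C) > c * real (num_inputs C) ^ 2" "num_outputs C > num_inputs C" for C
  proof (cases "num_inputs C \<le> n0")
    case True
    obtain \<alpha> where "unattainable (\<lambda>i. gate_fun (gates C ! i)) {..num_inputs C} \<alpha>"
      using unattainable_pigeonhole[of "gates C" "num_inputs C"] C by (auto simp: monotone_NC0_def)
    then have "small_obstruction (num_inputs C + 1) C"
      using C(3) unfolding small_obstruction_def by (intro exI[of _ "{..num_inputs C}"] exI) auto
    then show ?thesis using True by (elim K) (simp add: K_def)
  next
    case False
    define n where "n = real (num_inputs C)"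
    have big: "n \<ge> 730 / c + 12 / c ^ 2" using False by (simp add: n_def n0_def) linarith
    have pos: "730 / c > 0" "12 / c ^ 2 > 0" using \<open>c > 0\<close> by simp_all
    then have n1: "n \<ge> 730 / c" "n \<ge> 12 / c ^ 2" "n > 0" using big by linarith+
    have cn: "c * n \<ge> 730" "c ^ 2 * n \<ge> 12"
      using n1 \<open>c > 0\<close> by (simp_all add: field_simps)
    define d where "d = nat \<lfloor>c * n\<rfloor> - 364"
    have fl: "real (nat \<lfloor>c * n\<rfloor>) \<le> c * n" "real (nat \<lfloor>c * n\<rfloor>) > c * n - 1"
      using cn by linarith+
    then have d364: "d + 364 = nat \<lfloor>c * n\<rfloor>" using cn unfolding d_def by linarith
    then have d: "real d \<ge> c * n / 2" using fl cn by linarith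
    have "real ((d + 364) * num_inputs C) \<le> c * n * n"
      unfolding d364 using fl(1) n1(3) by (simp add: n_def mult_right_mono)
    also have "\<dots> < real (num_outputs C)" using C(2) by (simp add: n_def power2_eq_square)
    finally have A: "(d + 364) * num_inputs C < num_outputs C" by linarith
    have "3 * n \<le> (c ^ 2 * n) * n / 4" using cn(2) n1(3) by (simp add: field_simps)
    also have "\<dots> = (c * n / 2) * (c * n / 2)" by (simp add: power2_eq_square)
    also have "\<dots> \<le> real d * real d" using d cn by (intro mult_mono) auto
    finally have "real (3 * num_inputs C) \<le> real (d * d)" by (simp add: n_def)
    then have B: "3 * num_inputs C \<le> d * d" by linarith
    show ?thesis by (rule K[OF small_obstruction_dense[OF C(1) A B]]) (simp add: K_def)
  qed
  then show ?thesis by (rule that)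
qed

theorem mainTheorem3:
  fixes c :: real
  assumes "c > 0"
  shows "poly_time_solvable enc_circuit (enc_list enc_bool)
    {C. monotone_NC0 3 C \<and> real (num_outputs C) > c * real (num_inputs C) ^ 2 \<and>
        num_outputs C > num_inputs C}
    (\<lambda>C y. y \<in> bits (num_outputs C) \<and> y \<notin> circuit_range C)"
proof -
  obtain K where K: "\<And>C. monotone_NC0 3 C \<Longrightarrow>
      real (num_outputs C) > c * real (num_inputs C) ^ 2 \<Longrightarrow>
      num_outputs C > num_inputs C \<Longrightarrow> small_obstruction K C"
    using ex_small_obstruction[OF assms] by blast
  \<comment> \<open>At most \<open>K\<close> gates read at most \<open>3 * K\<close> variables, so
    that many ones suffice in the test. \<open>tl_data\<close> removes the success wrapper.\<close>
  define f where "f x = tl_data (search (3 * K) K Leaf Leaf x)" for x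
  have "ptime f"
    unfolding f_def by (intro ptime_tl ptime_search ptime_Leaf ptime_id)
  then obtain p q where
    pq: "\<And>x. runs p (input_store x) (poly q (size x)) (input_store (f x))" by (rule ptimeE) blast
  have "\<exists>y t. computes_in p (enc_circuit C) t (enc_list enc_bool y) \<and>
      t \<le> poly q (size (enc_circuit C)) \<and> y \<in> bits (num_outputs C) \<and> y \<notin> circuit_range C"
    if C: "monotone_NC0 3 C" "real (num_outputs C) > c * real (num_inputs C) ^ 2"
      "num_outputs C > num_inputs C" for C
  proof -
    let ?n = "num_inputs C" and ?gs = "gates C"
    have local: "\<And>g. g \<in> set ?gs \<Longrightarrow> local_gate 3 ?n g" using C(1) by (simp add: monotone_NC0_def)
    have enc: "enc_circuit C = Node (enc_nat ?n) (enc_list enc_gate ?gs)"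
      by (simp add: enc_circuit_def)
    have found: "search (3 * K) K Leaf Leaf (enc_circuit C) \<noteq> Leaf"
    proof
      assume fail: "search (3 * K) K Leaf Leaf (enc_circuit C) = Leaf"
      obtain W \<alpha> where W: "W \<subseteq> {..<length ?gs}" "card W \<le> K"
        "unattainable (\<lambda>i. gate_fun (?gs ! i)) W \<alpha>"
        using K[OF C] unfolding small_obstruction_def by blast
      define T where "T = sorted_list_of_set W"
      have T: "set T = W" "length T \<le> K"
        using W finite_subset[OF W(1)] by (simp_all add: T_def)
      have "sat (3 * K) (enc_list (suffix ?gs) T) (enc_list (suffix ?gs) (filter \<alpha> T)) Leaf
          (enc_nat ?n) \<noteq> Leaf"
        using search_complete[where gs = "gates C", OF local, where r = "3 * K" and k = K and T = "[]" and A = "[]" and W = T and a = \<alpha>] fail T W(1) by (simp add: enc)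
      moreover have "set T \<subseteq> {..<length ?gs}" "set (filter \<alpha> T) \<subseteq> {..<length ?gs}"
        using T W(1) by auto
      ultimately obtain \<zeta> where "agrees ?gs T (filter \<alpha> T) \<zeta>"
        using sat_iff_ex_agrees[OF local, where T = T and A = "filter \<alpha> T" and k = "3 * K"] T(2) by auto
      then have "\<forall>i\<in>W. gate_fun (?gs ! i) \<zeta> = \<alpha> i"
        using T(1) by (auto simp: agrees_def)
      then show False using W(3) by (auto simp: unattainable_def)
    qed
    obtain T A where TA: "length T \<le> K" "set T \<subseteq> {..<length ?gs}" "set A \<subseteq> {..<length ?gs}"
      "sat (3 * K) (enc_list (suffix ?gs) T) (enc_list (suffix ?gs) A) Leaf (enc_nat ?n) = Leaf"
      "search (3 * K) K Leaf Leaf (enc_circuit C) =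
        Node Leaf (indicator_list (enc_list (suffix ?gs) A) (enc_list enc_gate ?gs))"
      using search_sound[where gs = "gates C", OF local, where r = "3 * K" and k = K and T = "[]" and A = "[]"] found unfolding enc by (auto simp del: search.simps)
    \<comment> \<open>On \<open>T\<close> this is the unattainable pattern. Any values on the other
      outputs would do; they are read off from \<open>A\<close> as well.\<close>
    define y where "y = map (\<lambda>i. i \<in> set A) [0..<length ?gs]"
    have "f (enc_circuit C) = enc_list enc_bool y"
      using TA(5) indicator_list_eq[OF local TA(3)] by (simp add: f_def y_def)
    moreover obtain t where "t \<le> poly q (size (enc_circuit C))"
      "exec p (input_store (enc_circuit C)) t (input_store (f (enc_circuit C)))"
      using pq unfolding runs_def by blast
    ultimately have "computes_in p (enc_circuit C) t (enc_list enc_bool y)"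
      "t \<le> poly q (size (enc_circuit C))"
      unfolding computes_in_def input_store_eq by auto
    moreover have "y \<in> bits (num_outputs C)" by (simp add: y_def bits_def)
    moreover have "y \<notin> circuit_range C"
    proof
      assume "y \<in> circuit_range C"
      then obtain x where "y = eval_circuit C x" unfolding circuit_range_def by blast
      have "gate_fun (?gs ! i) ((!) x) = (i \<in> set A)" if "i < length ?gs" for i
      proof -
        have "y ! i = eval_circuit C x ! i" using \<open>y = eval_circuit C x\<close> by (rule arg_cong)
        then show ?thesis using that by (simp add: y_def eval_circuit_def eval_gate_eq)
      qed
      then have "agrees ?gs T A ((!) x)" using TA(2) by (auto simp: agrees_def)
      then show False
        using sat_iff_ex_agrees[OF local TA(2,3), where k = "3 * K"] TA(1,4) by auto
    qed
    ultimately show ?thesis by blast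
  qed
  then show ?thesis unfolding poly_time_solvable_def by blast
qed

end
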